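(* The subalgebra $\mathrm Y^{\rm tw}_q(\mathfrak{sp}_{2n})$ of $\mathrm U_q(\widehat{\mathfrak{gl}}_{2n})$ is a left coideal, that is, $\Delta(\mathrm Y^{\rm tw}_q(\mathfrak{sp}_{2n}))\subset \mathrm U_q(\widehat{\mathfrak{gl}}_{2n})\otimes\mathrm Y^{\rm tw}_q(\mathfrak{sp}_{2n})$, and $$\Delta(s_{ij}(u))=\sum_{k,l=1}^{2n} t_{ik}(u)\,\bar t_{jl}(u^{-1})\otimes s_{kl}(u)\qquad(1\le i,j\le 2n).$$
   Context: Fix $q\in\mathbb C$, nonzero and not a root of unity, and put $N=2n$. $E_{ij}$ are matrix units; a matrix $M=(m_{ij})$ over an algebra is identified with $\sum m_{ij}\otimes E_{ij}$, $M^t$ is its transpose, and $M_a$ means that $M$ acts in the $a$-th copy of $\mathrm{End}\,\mathbb C^N$. Put $$R(u,v)=(u-v)\sum_{i\ne j}E_{ii}\otimes E_{jj}+(q^{-1}u-qv)\sum_iE_{ii}\otimes E_{ii}+(q^{-1}-q)u\sum_{i>j}E_{ij}\otimes E_{ji}+(q^{-1}-q)v\sum_{i<j}E_{ij}\otimes E_{ji}.$$ The quantum affine algebra $\mathrm U_q(\widehat{\mathfrak{gl}}_N)$ is generated by $t_{ij}^{(r)},\bar t_{ij}^{\,(r)}$ ($1\le i,j\le N$, $r\ge0$). With $t_{ij}(u)=\sum_{r\ge0}t_{ij}^{(r)}u^{-r}$, $\bar t_{ij}(u)=\sum_{r\ge0}\bar t_{ij}^{\,(r)}u^{r}$, $T(u)=(t_{ij}(u))$,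 $\overline T(u)=(\bar t_{ij}(u))$, the defining relations are: $t_{ij}^{(0)}=\bar t_{ji}^{\,(0)}=0$ for $i<j$; $t_{ii}^{(0)}\bar t_{ii}^{\,(0)}=\bar t_{ii}^{\,(0)}t_{ii}^{(0)}=1$; $R(u,v)T_1(u)T_2(v)=T_2(v)T_1(u)R(u,v)$; $R(u,v)\overline T_1(u)\overline T_2(v)=\overline T_2(v)\overline T_1(u)R(u,v)$; $R(u,v)\overline T_1(u)T_2(v)=T_2(v)\overline T_1(u)R(u,v)$. It is a Hopf algebra with coproduct $\Delta(t_{ij}(u))=\sum_k t_{ik}(u)\otimes t_{kj}(u)$, $\Delta(\bar t_{ij}(u))=\sum_k\bar t_{ik}(u)\otimes\bar t_{kj}(u)$. The prime denotes the involution of $\{1,\dots,2n\}$ with $(2k-1)'=2k$, $(2k)'=2k-1$. Let $G=q\sum_{k=1}^nE_{2k-1,2k}-\sum_{k=1}^nE_{2k,2k-1}$. $\mathrm Y^{\rm tw}_q(\mathfrak{sp}_{2n})$ is the subalgebra generated by the coefficients $s_{ij}^{(r)}$ of the entries $s_{ij}(u)=\sum_{r\ge0}s_{ij}^{(r)}u^{-r}$ of the matrix $S(u)=T(u)\,G\,\overline T(u^{-1})^t$ and by the elements $(s_{ii'}^{(0)})^{-1}$, $i=1,3,\dots,2n-1$ (where $s_{ii'}^{(0)}=q\,t_{ii}^{(0)}\bar t_{i'i'}^{\,(0)}$ is invertible). *)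

theory Defs
  imports
    "HOL-Computational_Algebra.Polynomial"
    "HOL-Algebra.Module"
    "HOL-Algebra.QuotRing"
    "HOL-Algebra.Subrings"
begin

hide_const (open) Polynomial.smult

section \<open>Associative algebras over the complex numbers\<close>

text \<open>
  A unital associative (in general noncommutative) \<open>\<complex>\<close>-algebra is a record of type
  \<open>(complex, 'a) module\<close>.
\<close>

definition alg_hom ::
    "(complex, 'a) module \<Rightarrow> (complex, 'b) module \<Rightarrow> ('a \<Rightarrow> 'b) set" where
  "alg_hom A B =
     {h \<in> ring_hom A B. \<forall>c. \<forall>x\<in>carrier A. h (c \<odot>\<^bsub>A\<^esub> x) = c \<odot>\<^bsub>B\<^esub> h x}"

definition is_subalg :: "'a set \<Rightarrow> (complex, 'a) module \<Rightarrow> bool" where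
  "is_subalg B A \<longleftrightarrow> subring B A \<and> (\<forall>c. \<forall>b\<in>B. c \<odot>\<^bsub>A\<^esub> b \<in> B)"

definition subalg_gen :: "(complex, 'a) module \<Rightarrow> 'a set \<Rightarrow> 'a set" where
  "subalg_gen A X = \<Inter>{B. is_subalg B A \<and> X \<subseteq> B}"

definition monoid_alg :: "('g, 'm) monoid_scheme \<Rightarrow> (complex, 'g \<Rightarrow> complex) module" where
  "monoid_alg M =
    \<lparr>carrier = {f. finite {x. f x \<noteq> 0} \<and> {x. f x \<noteq> 0} \<subseteq> carrier M},
     mult = (\<lambda>f g z. \<Sum>x\<in>{x. f x \<noteq> 0}. \<Sum>y\<in>{y. g y \<noteq> 0}.
               if x \<otimes>\<^bsub>M\<^esub> y = z then f x * g y else 0),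
     one = (\<lambda>x. if x = \<one>\<^bsub>M\<^esub> then 1 else 0),
     zero = (\<lambda>_. 0),
     add = (\<lambda>f g x. f x + g x),
     smult = (\<lambda>c f x. c * f x)\<rparr>"

definition basis_elt :: "'g \<Rightarrow> 'g \<Rightarrow> complex" where
  "basis_elt x = (\<lambda>y. if y = x then 1 else 0)"

definition word_monoid :: "'g set \<Rightarrow> 'g list monoid" where
  "word_monoid X = \<lparr>carrier = lists X, mult = (@), one = []\<rparr>"

definition free_alg :: "'g set \<Rightarrow> (complex, 'g list \<Rightarrow> complex) module" where
  "free_alg X = monoid_alg (word_monoid X)"

text \<open>
  The quotient by a two-sided ideal \<open>I\<close>. The scalar multiple of a coset \<open>X\<close> is written as a union so
  that it is again a full coset for the scalar 0.
\<close>

definition alg_quot :: "(complex, 'a) module \<Rightarrow> 'a set \<Rightarrow> (complex, 'a set) module" where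
  "alg_quot A I =
    \<lparr>carrier = carrier (A Quot I),
     mult = mult (A Quot I),
     one = one (A Quot I),
     zero = zero (A Quot I),
     add = add (A Quot I),
     smult = (\<lambda>c X. \<Union>x\<in>X. I +>\<^bsub>A\<^esub> (c \<odot>\<^bsub>A\<^esub> x))\<rparr>"


section \<open>Tensor products\<close>

text \<open>
  The tensor product of algebras is the free vector space on \<open>carrier A \<times> carrier B\<close> modulo the
  bilinearity relations. The free vector space carries the product
  \<open>(a, b) (a', b') = (a a', b b')\<close>. The set of relations is stable, up to relations, under
  multiplication by basis elements on either side, so the two-sided ideal it generates is its
  linear span.
\<close>

definition bilinear_rels ::
    "(complex, 'a) module \<Rightarrow> (complex, 'b) module \<Rightarrow> ('a \<times> 'b \<Rightarrow> complex) set" where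
  "bilinear_rels A B = (let F = monoid_alg (A \<times>\<times> B) in
     {basis_elt (a \<oplus>\<^bsub>A\<^esub> a', b) \<ominus>\<^bsub>F\<^esub> (basis_elt (a, b) \<oplus>\<^bsub>F\<^esub> basis_elt (a', b)) | a a' b.
        a \<in> carrier A \<and> a' \<in> carrier A \<and> b \<in> carrier B} \<union>
     {basis_elt (a, b \<oplus>\<^bsub>B\<^esub> b') \<ominus>\<^bsub>F\<^esub> (basis_elt (a, b) \<oplus>\<^bsub>F\<^esub> basis_elt (a, b')) | a b b'.
        a \<in> carrier A \<and> b \<in> carrier B \<and> b' \<in> carrier B} \<union>
     {basis_elt (c \<odot>\<^bsub>A\<^esub> a, b) \<ominus>\<^bsub>F\<^esub> c \<odot>\<^bsub>F\<^esub> basis_elt (a, b) | c a b.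
        a \<in> carrier A \<and> b \<in> carrier B} \<union>
     {basis_elt (a, c \<odot>\<^bsub>B\<^esub> b) \<ominus>\<^bsub>F\<^esub> c \<odot>\<^bsub>F\<^esub> basis_elt (a, b) | c a b.
        a \<in> carrier A \<and> b \<in> carrier B})"

definition tensor_ideal ::
    "(complex, 'a) module \<Rightarrow> (complex, 'b) module \<Rightarrow> ('a \<times> 'b \<Rightarrow> complex) set" where
  "tensor_ideal A B = Idl\<^bsub>monoid_alg (A \<times>\<times> B)\<^esub> (bilinear_rels A B)"

definition alg_tensor ::
    "(complex, 'a) module \<Rightarrow> (complex, 'b) module \<Rightarrow> (complex, ('a \<times> 'b \<Rightarrow> complex) set) module"
  where
  "alg_tensor A B = alg_quot (monoid_alg (A \<times>\<times> B)) (tensor_ideal A B)"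

definition pure_tensor ::
    "(complex, 'a) module \<Rightarrow> (complex, 'b) module \<Rightarrow> 'a \<Rightarrow> 'b \<Rightarrow> ('a \<times> 'b \<Rightarrow> complex) set" where
  "pure_tensor A B a b = tensor_ideal A B +>\<^bsub>monoid_alg (A \<times>\<times> B)\<^esub> basis_elt (a, b)"

text \<open>
  For subspaces \<open>X\<close> of \<open>A\<close> and \<open>Z\<close> of \<open>B\<close>, the tensor product of \<open>X\<close> and \<open>Z\<close>
  regarded as a subspace of the tensor product of \<open>A\<close> and \<open>B\<close> (over a field the canonical map is
  injective).
\<close>

definition sub_tensor ::
    "(complex, 'a) module \<Rightarrow> (complex, 'b) module \<Rightarrow> 'a set \<Rightarrow> 'b set
       \<Rightarrow> ('a \<times> 'b \<Rightarrow> complex) set set" where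
  "sub_tensor A B X Z =
     {(\<Oplus>\<^bsub>alg_tensor A B\<^esub>i\<in>{..<m}. pure_tensor A B (x i) (z i)) | (m::nat) x z.
        (\<forall>i<m. x i \<in> X \<and> z i \<in> Z)}"


section \<open>Formal series and matrices\<close>

text \<open>
  One-sided formal series over \<open>A\<close>, given by their coefficients. The formal variable is
  \<open>u\<^sup>-\<^sup>1\<close> for \<open>t\<^sub>i\<^sub>j(u)\<close>, \<open>s\<^sub>i\<^sub>j(u)\<close> and \<open>\<bar>t\<^sub>i\<^sub>j(u\<^sup>-\<^sup>1)\<close>, and \<open>u\<close> for \<open>\<bar>t\<^sub>i\<^sub>j(u)\<close>.
\<close>

definition series_ring :: "(complex, 'a) module \<Rightarrow> (nat \<Rightarrow> 'a) ring" where
  "series_ring A =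
    \<lparr>carrier = {f. \<forall>r. f r \<in> carrier A},
     mult = (\<lambda>f g r. \<Oplus>\<^bsub>A\<^esub>a\<in>{..r}. f a \<otimes>\<^bsub>A\<^esub> g (r - a)),
     one = (\<lambda>r. if r = 0 then \<one>\<^bsub>A\<^esub> else \<zero>\<^bsub>A\<^esub>),
     zero = (\<lambda>_. \<zero>\<^bsub>A\<^esub>),
     add = (\<lambda>f g r. f r \<oplus>\<^bsub>A\<^esub> g r)\<rparr>"

definition const_series :: "(complex, 'a) module \<Rightarrow> complex \<Rightarrow> nat \<Rightarrow> 'a" where
  "const_series A c = (\<lambda>r. if r = 0 then c \<odot>\<^bsub>A\<^esub> \<one>\<^bsub>A\<^esub> else \<zero>\<^bsub>A\<^esub>)"

definition series_tensor ::
    "(complex, 'a) module \<Rightarrow> (complex, 'b) module \<Rightarrow> (nat \<Rightarrow> 'a) \<Rightarrow> (nat \<Rightarrow> 'b)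
       \<Rightarrow> nat \<Rightarrow> ('a \<times> 'b \<Rightarrow> complex) set" where
  "series_tensor A B f g =
     (\<lambda>r. \<Oplus>\<^bsub>alg_tensor A B\<^esub>a\<in>{..r}. pure_tensor A B (f a) (g (r - a)))"

type_synonym 'a mat = "nat \<Rightarrow> nat \<Rightarrow> 'a"

text \<open>Matrices are indexed by \<open>{1..N}\<close>; entries outside this range are irrelevant.\<close>

definition mat_prod :: "('a, 'm) ring_scheme \<Rightarrow> nat \<Rightarrow> 'a mat \<Rightarrow> 'a mat \<Rightarrow> 'a mat" where
  "mat_prod R N M M' = (\<lambda>i j. \<Oplus>\<^bsub>R\<^esub>k\<in>{1..N}. M i k \<otimes>\<^bsub>R\<^esub> M' k j)"

definition mat_transpose :: "'a mat \<Rightarrow> 'a mat" where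
  "mat_transpose M = (\<lambda>i j. M j i)"

definition mat_unit :: "nat \<Rightarrow> nat \<Rightarrow> 'a::zero_neq_one mat" where
  "mat_unit a b = (\<lambda>i j. if i = a \<and> j = b then 1 else 0)"


section \<open>The quantum affine algebra\<close>

text \<open>
  Polynomials in \<open>u, v\<close> are elements of \<open>complex poly poly\<close>, with \<open>u\<close> the outer and \<open>v\<close> the inner
  variable.
\<close>

definition var_u :: "complex poly poly" where "var_u = [:0, 1:]"
definition var_v :: "complex poly poly" where "var_v = [:[:0, 1:]:]"
definition cst :: "complex \<Rightarrow> complex poly poly" where "cst c = [:[:c:]:]"

text \<open>\<open>Rmat N q i j k l\<close> is the coefficient of \<open>E\<^sub>i\<^sub>j \<otimes> E\<^sub>k\<^sub>l\<close> in \<open>R(u,v)\<close>.\<close>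

definition Rmat :: "nat \<Rightarrow> complex \<Rightarrow> nat \<Rightarrow> nat \<Rightarrow> nat \<Rightarrow> nat \<Rightarrow> complex poly poly" where
  "Rmat N q i j k l =
     (var_u - var_v) *
       (\<Sum>a\<in>{1..N}. \<Sum>b\<in>{1..N} - {a}. mat_unit a a i j * mat_unit b b k l)
   + (cst (inverse q) * var_u - cst q * var_v) *
       (\<Sum>a\<in>{1..N}. mat_unit a a i j * mat_unit a a k l)
   + cst (inverse q - q) * var_u *
       (\<Sum>a\<in>{1..N}. \<Sum>b\<in>{b\<in>{1..N}. a > b}. mat_unit a b i j * mat_unit b a k l)
   + cst (inverse q - q) * var_v *
       (\<Sum>a\<in>{1..N}. \<Sum>b\<in>{b\<in>{1..N}. a < b}. mat_unit a b i j * mat_unit b a k l)"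

text \<open>
  Two-sided formal series in \<open>u, v\<close> are functions \<open>F\<close> with \<open>F m p\<close> the coefficient of
  \<open>u\<^sup>m v\<^sup>p\<close>; they are multiplied by polynomials in \<open>u, v\<close> as follows.
\<close>

definition poly_act ::
    "(complex, 'a) module \<Rightarrow> complex poly poly \<Rightarrow> (int \<Rightarrow> int \<Rightarrow> 'a) \<Rightarrow> int \<Rightarrow> int \<Rightarrow> 'a" where
  "poly_act A P F m p =
     (\<Oplus>\<^bsub>A\<^esub>c\<in>{..degree P}. \<Oplus>\<^bsub>A\<^esub>d\<in>{..degree (poly.coeff P c)}.
        poly.coeff (poly.coeff P c) d \<odot>\<^bsub>A\<^esub> F (m - int c) (p - int d))"

text \<open>
  The coefficients of \<open>u\<^sup>m v\<^sup>p\<close> in the \<open>E\<^sub>i\<^sub>j \<otimes> E\<^sub>k\<^sub>l\<close> components of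
  \<open>R(u,v) X\<^sub>1(u) Y\<^sub>2(v)\<close> and of \<open>Y\<^sub>2(v) X\<^sub>1(u) R(u,v)\<close>.
\<close>

definition rtt_left ::
    "(complex, 'a) module \<Rightarrow> nat \<Rightarrow> complex \<Rightarrow> (int \<Rightarrow> 'a) mat \<Rightarrow> (int \<Rightarrow> 'a) mat
       \<Rightarrow> nat \<Rightarrow> nat \<Rightarrow> nat \<Rightarrow> nat \<Rightarrow> int \<Rightarrow> int \<Rightarrow> 'a" where
  "rtt_left A N q X Y i j k l m p =
     (\<Oplus>\<^bsub>A\<^esub>a\<in>{1..N}. \<Oplus>\<^bsub>A\<^esub>b\<in>{1..N}.
        poly_act A (Rmat N q i a k b) (\<lambda>m p. X a j m \<otimes>\<^bsub>A\<^esub> Y b l p) m p)"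

definition rtt_right ::
    "(complex, 'a) module \<Rightarrow> nat \<Rightarrow> complex \<Rightarrow> (int \<Rightarrow> 'a) mat \<Rightarrow> (int \<Rightarrow> 'a) mat
       \<Rightarrow> nat \<Rightarrow> nat \<Rightarrow> nat \<Rightarrow> nat \<Rightarrow> int \<Rightarrow> int \<Rightarrow> 'a" where
  "rtt_right A N q X Y i j k l m p =
     (\<Oplus>\<^bsub>A\<^esub>a\<in>{1..N}. \<Oplus>\<^bsub>A\<^esub>b\<in>{1..N}.
        poly_act A (Rmat N q a j b l) (\<lambda>m p. Y k b p \<otimes>\<^bsub>A\<^esub> X i a m) m p)"

definition rtt_rels ::
    "(complex, 'a) module \<Rightarrow> nat \<Rightarrow> complex \<Rightarrow> (int \<Rightarrow> 'a) mat \<Rightarrow> (int \<Rightarrow> 'a) mat \<Rightarrow> 'a set" where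
  "rtt_rels A N q X Y =
     {rtt_left A N q X Y i j k l m p \<ominus>\<^bsub>A\<^esub> rtt_right A N q X Y i j k l m p | i j k l m p.
        i \<in> {1..N} \<and> j \<in> {1..N} \<and> k \<in> {1..N} \<and> l \<in> {1..N}}"

datatype gen = Gen_t nat nat nat | Gen_tbar nat nat nat

definition gens :: "nat \<Rightarrow> gen set" where
  "gens N = {Gen_t i j r | i j r. i \<in> {1..N} \<and> j \<in> {1..N}} \<union>
            {Gen_tbar i j r | i j r. i \<in> {1..N} \<and> j \<in> {1..N}}"

abbreviation word_t :: "nat \<Rightarrow> nat \<Rightarrow> nat \<Rightarrow> gen list \<Rightarrow> complex" where
  "word_t i j r \<equiv> basis_elt [Gen_t i j r]"

abbreviation word_tbar :: "nat \<Rightarrow> nat \<Rightarrow> nat \<Rightarrow> gen list \<Rightarrow> complex" where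
  "word_tbar i j r \<equiv> basis_elt [Gen_tbar i j r]"

text \<open>\<open>T(u)\<close> has coefficients in nonpositive, \<open>\<bar>T(u)\<close> in nonnegative powers of \<open>u\<close>.\<close>

definition Tmat :: "(int \<Rightarrow> gen list \<Rightarrow> complex) mat" where
  "Tmat i j = (\<lambda>m. if m \<le> 0 then word_t i j (nat (- m)) else (\<lambda>_. 0))"

definition Tbarmat :: "(int \<Rightarrow> gen list \<Rightarrow> complex) mat" where
  "Tbarmat i j = (\<lambda>m. if m \<ge> 0 then word_tbar i j (nat m) else (\<lambda>_. 0))"

definition Uq_rels :: "nat \<Rightarrow> complex \<Rightarrow> (gen list \<Rightarrow> complex) set" where
  "Uq_rels N q = (let F = free_alg (gens N) in
     {word_t i j 0 | i j. i \<in> {1..N} \<and> j \<in> {1..N} \<and> i < j} \<union>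
     {word_tbar j i 0 | i j. i \<in> {1..N} \<and> j \<in> {1..N} \<and> i < j} \<union>
     {word_t i i 0 \<otimes>\<^bsub>F\<^esub> word_tbar i i 0 \<ominus>\<^bsub>F\<^esub> \<one>\<^bsub>F\<^esub> | i. i \<in> {1..N}} \<union>
     {word_tbar i i 0 \<otimes>\<^bsub>F\<^esub> word_t i i 0 \<ominus>\<^bsub>F\<^esub> \<one>\<^bsub>F\<^esub> | i. i \<in> {1..N}} \<union>
     rtt_rels F N q Tmat Tmat \<union>
     rtt_rels F N q Tbarmat Tbarmat \<union>
     rtt_rels F N q Tbarmat Tmat)"

definition Uq_ideal :: "nat \<Rightarrow> complex \<Rightarrow> (gen list \<Rightarrow> complex) set" where
  "Uq_ideal N q = Idl\<^bsub>free_alg (gens N)\<^esub> (Uq_rels N q)"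

definition Uq :: "nat \<Rightarrow> complex \<Rightarrow> (complex, (gen list \<Rightarrow> complex) set) module" where
  "Uq N q = alg_quot (free_alg (gens N)) (Uq_ideal N q)"

text \<open>
  The series \<open>t\<^sub>i\<^sub>j(u)\<close> in \<open>u\<^sup>-\<^sup>1\<close>, and \<open>\<bar>t\<^sub>i\<^sub>j\<close>, which is both the series
  \<open>\<bar>t\<^sub>i\<^sub>j(u)\<close> in \<open>u\<close> and the series \<open>\<bar>t\<^sub>i\<^sub>j(u\<^sup>-\<^sup>1)\<close> in \<open>u\<^sup>-\<^sup>1\<close>.
\<close>

definition t_ser :: "nat \<Rightarrow> complex \<Rightarrow> (nat \<Rightarrow> (gen list \<Rightarrow> complex) set) mat" where
  "t_ser N q i j = (\<lambda>r. Uq_ideal N q +>\<^bsub>free_alg (gens N)\<^esub> word_t i j r)"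

definition tbar_ser :: "nat \<Rightarrow> complex \<Rightarrow> (nat \<Rightarrow> (gen list \<Rightarrow> complex) set) mat" where
  "tbar_ser N q i j = (\<lambda>r. Uq_ideal N q +>\<^bsub>free_alg (gens N)\<^esub> word_tbar i j r)"

text \<open>
  The coproduct; the conditions determine it on the carrier, since the algebra is generated by the
  coefficients of \<open>t\<^sub>i\<^sub>j(u)\<close> and \<open>\<bar>t\<^sub>i\<^sub>j(u)\<close>.
\<close>

definition is_coproduct ::
    "nat \<Rightarrow> complex \<Rightarrow>
     ((gen list \<Rightarrow> complex) set \<Rightarrow>
        ((gen list \<Rightarrow> complex) set \<times> (gen list \<Rightarrow> complex) set \<Rightarrow> complex) set) \<Rightarrow> bool" where
  "is_coproduct N q \<Delta> \<longleftrightarrow> (let U = Uq N q; UU = alg_tensor U U in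
     \<Delta> \<in> alg_hom U UU \<and>
     (\<forall>i\<in>{1..N}. \<forall>j\<in>{1..N}.
        (\<lambda>r. \<Delta> (t_ser N q i j r)) =
          (\<Oplus>\<^bsub>series_ring UU\<^esub>k\<in>{1..N}. series_tensor U U (t_ser N q i k) (t_ser N q k j)) \<and>
        (\<lambda>r. \<Delta> (tbar_ser N q i j r)) =
          (\<Oplus>\<^bsub>series_ring UU\<^esub>k\<in>{1..N}. series_tensor U U (tbar_ser N q i k) (tbar_ser N q k j))))"


section \<open>The symplectic twisted q-Yangian\<close>

definition idx_prime :: "nat \<Rightarrow> nat" where
  "idx_prime i = (if odd i then i + 1 else i - 1)"

definition Gmat :: "nat \<Rightarrow> complex \<Rightarrow> complex mat" where
  "Gmat n q i j = q * (\<Sum>k\<in>{1..n}. mat_unit (2 * k - 1) (2 * k) i j)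
                  - (\<Sum>k\<in>{1..n}. mat_unit (2 * k) (2 * k - 1) i j)"

definition s_ser :: "nat \<Rightarrow> complex \<Rightarrow> (nat \<Rightarrow> (gen list \<Rightarrow> complex) set) mat" where
  "s_ser n q = (let U = Uq (2 * n) q; R = series_ring U in
     mat_prod R (2 * n)
       (mat_prod R (2 * n) (t_ser (2 * n) q) (\<lambda>i j. const_series U (Gmat n q i j)))
       (mat_transpose (tbar_ser (2 * n) q)))"

definition Ytw_sp :: "nat \<Rightarrow> complex \<Rightarrow> (gen list \<Rightarrow> complex) set set" where
  "Ytw_sp n q = subalg_gen (Uq (2 * n) q)
     ({s_ser n q i j r | i j r. i \<in> {1..2 * n} \<and> j \<in> {1..2 * n}} \<union>
      {inv\<^bsub>Uq (2 * n) q\<^esub> (s_ser n q i (idx_prime i) 0) | i. i \<in> {1..2 * n} \<and> odd i})"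

end

theory Submission
  imports Defs "HOL-Algebra.UnivPoly"
begin

text \<open>
  Apply \<open>\<Delta>\<close> to series coefficientwise, and let \<open>L f = f \<otimes> 1\<close> and \<open>R f = 1 \<otimes> f\<close> be the two
  embeddings of series over \<open>U\<close> into series over \<open>U \<otimes> U\<close>; their images commute. The coproduct is
  given by \<open>\<Delta>(T) = L(T) R(T)\<close> and \<open>\<Delta>(\<bar>T) = L(\<bar>T) R(\<bar>T)\<close>, and commutation turns the transpose of
  the latter into \<open>R(\<bar>T\<^sup>t) L(\<bar>T\<^sup>t)\<close>. Since \<open>\<Delta>(G) = R(G)\<close>, the matrix \<open>S = T G \<bar>T\<^sup>t\<close> satisfies
  \<open>\<Delta>(S) = L(T) R(T) R(G) R(\<bar>T\<^sup>t) L(\<bar>T\<^sup>t) = L(T) R(S) L(\<bar>T\<^sup>t)\<close>.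

  The elements that \<open>\<Delta>\<close> maps into \<open>U \<otimes> Y\<close> form a subalgebra, so the coideal property need only be
  checked on generators. At order 0 the matrices \<open>T\<close> and \<open>\<bar>T\<close> are triangular with invertible
  group-like diagonal entries, which leaves \<open>s = q x\<close> with \<open>x = t\<^sub>i\<^sub>i \<bar>t\<^sub>i\<^sub>'\<^sub>i\<^sub>'\<close> for the entry of \<open>S\<close> at
  \<open>(i, i')\<close>. Hence \<open>\<Delta>(s) = x \<otimes> s\<close> and \<open>\<Delta>(s\<^sup>-\<^sup>1) = x\<^sup>-\<^sup>1 \<otimes> s\<^sup>-\<^sup>1\<close>.
\<close>

section \<open>Rings and complex algebras\<close>

context abelian_monoid
begin

lemma finsum_swap:
  assumes "finite I" "finite J" "\<And>i j. i \<in> I \<Longrightarrow> j \<in> J \<Longrightarrow> f i j \<in> carrier G"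
  shows "(\<Oplus>i\<in>I. \<Oplus>j\<in>J. f i j) = (\<Oplus>j\<in>J. \<Oplus>i\<in>I. f i j)"
  using assms(1,3)
proof (induction I rule: finite_induct)
  case (insert x I)
  have "(\<Oplus>i\<in>insert x I. \<Oplus>j\<in>J. f i j) = (\<Oplus>j\<in>J. f x j) \<oplus> (\<Oplus>j\<in>J. \<Oplus>i\<in>I. f i j)"
    using insert by (simp add: Pi_def)
  also have "\<dots> = (\<Oplus>j\<in>J. f x j \<oplus> (\<Oplus>i\<in>I. f i j))"
    using insert by (simp add: finsum_addf Pi_def)
  also have "\<dots> = (\<Oplus>j\<in>J. \<Oplus>i\<in>insert x I. f i j)"
    using insert by (intro finsum_cong') auto
  finally show ?case .
qed simp

lemma finsum_eq_single:
  assumes "finite I" "i \<in> I" "f i \<in> carrier G" "\<And>j. j \<in> I \<Longrightarrow> j \<noteq> i \<Longrightarrow> f j = \<zero>"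
  shows "(\<Oplus>j\<in>I. f j) = f i"
proof -
  have "(\<Oplus>j\<in>I. f j) = (\<Oplus>j\<in>I. if i = j then f i else \<zero>)"
    using assms by (intro finsum_cong') auto
  also have "\<dots> = f i"
    using assms by (intro finsum_singleton[of i I "\<lambda>_. f i"]) auto
  finally show ?thesis .
qed

lemma finsum_lessThan_Suc:
  assumes "\<And>i. i < Suc m \<Longrightarrow> f i \<in> carrier G"
  shows "(\<Oplus>i\<in>{..<Suc m}. f i) = (\<Oplus>i\<in>{..<m}. f i) \<oplus> f m"
  using assms by (simp add: lessThan_Suc a_comm Pi_def)

end

locale complex_alg = ring A for A :: "(complex, 'a) module" (structure) +
  assumes smult_closed [simp, intro]: "x \<in> carrier A \<Longrightarrow> c \<odot> x \<in> carrier A"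
    and smult_r_distr: "x \<in> carrier A \<Longrightarrow> y \<in> carrier A \<Longrightarrow> c \<odot> (x \<oplus> y) = c \<odot> x \<oplus> c \<odot> y"
    and smult_l_distr: "x \<in> carrier A \<Longrightarrow> (c + d) \<odot> x = c \<odot> x \<oplus> d \<odot> x"
    and smult_assoc: "x \<in> carrier A \<Longrightarrow> (c * d) \<odot> x = c \<odot> (d \<odot> x)"
    and smult_one [simp]: "x \<in> carrier A \<Longrightarrow> 1 \<odot> x = x"
    and smult_mult_left: "x \<in> carrier A \<Longrightarrow> y \<in> carrier A \<Longrightarrow> c \<odot> x \<otimes> y = c \<odot> (x \<otimes> y)"
    and smult_mult_right: "x \<in> carrier A \<Longrightarrow> y \<in> carrier A \<Longrightarrow> x \<otimes> (c \<odot> y) = c \<odot> (x \<otimes> y)"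
begin

lemma smult_zero_left: "x \<in> carrier A \<Longrightarrow> 0 \<odot> x = \<zero>"
  using smult_l_distr[of x 0 0] add.l_cancel_one'[of "0 \<odot> x" "0 \<odot> x"] by simp

lemma smult_zero_right [simp]: "c \<odot> \<zero> = \<zero>"
  using smult_r_distr[of \<zero> \<zero> c] add.l_cancel_one'[of "c \<odot> \<zero>" "c \<odot> \<zero>"] by simp

lemma smult_minus_one: "x \<in> carrier A \<Longrightarrow> (- 1) \<odot> x = \<ominus> x"
  using smult_l_distr[of x "- 1" 1]
  by (intro minus_equality[symmetric]) (simp_all add: smult_zero_left)

lemma Units_smult:
  assumes "c \<noteq> 0" "x \<in> Units A"
  shows "c \<odot> x \<in> Units A"
proof -
  have "c \<odot> x \<in> carrier A" "inverse c \<odot> inv x \<in> carrier A"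
    using assms(2) by auto
  moreover have "c \<odot> x \<otimes> (inverse c \<odot> inv x) = \<one>" "inverse c \<odot> inv x \<otimes> (c \<odot> x) = \<one>"
    using assms by (simp_all add: smult_mult_left smult_mult_right Units_closed flip: smult_assoc)
  ultimately show ?thesis
    unfolding Units_def by blast
qed

lemma ideal_smult_closed:
  assumes "ideal I A" "x \<in> I"
  shows "c \<odot> x \<in> I"
proof -
  interpret I: ideal I A by fact
  have "c \<odot> x = c \<odot> \<one> \<otimes> x"
    using I.a_Hcarr[OF assms(2)] by (simp add: smult_mult_left)
  then show ?thesis
    using assms(2) I.I_l_closed by simp
qed

lemma coset_eq_if_diff_in_genideal:
  assumes "X \<subseteq> carrier A" "x \<ominus> y \<in> X" "x \<in> carrier A" "y \<in> carrier A"
  shows "Idl X +> x = Idl X +> y"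
  using quotient_eq_iff_same_a_r_cos[OF genideal_ideal[OF assms(1)] assms(3,4)]
    genideal_self[OF assms(1)] assms(2) by blast

end

context ring_hom_ring
begin

lemma hom_inv:
  assumes "x \<in> Units R"
  shows "h (inv x) = inv\<^bsub>S\<^esub> h x"
proof (rule S.inv_unique')
  show "h x \<otimes>\<^bsub>S\<^esub> h (inv x) = \<one>\<^bsub>S\<^esub>" "h (inv x) \<otimes>\<^bsub>S\<^esub> h x = \<one>\<^bsub>S\<^esub>"
    using assms by (simp_all flip: hom_mult add: R.Units_closed)
qed (use assms in auto)

end

lemma alg_homD:
  assumes "complex_alg A" "complex_alg B" "h \<in> alg_hom A B"
  shows "ring_hom_ring A B h" and "x \<in> carrier A \<Longrightarrow> h (c \<odot>\<^bsub>A\<^esub> x) = c \<odot>\<^bsub>B\<^esub> h x"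
proof -
  have "h \<in> ring_hom A B"
    using assms(3) by (simp add: alg_hom_def)
  then show "ring_hom_ring A B h"
    using assms(1,2) by (intro ring_hom_ringI2) (simp_all add: complex_alg_def)
  show "x \<in> carrier A \<Longrightarrow> h (c \<odot>\<^bsub>A\<^esub> x) = c \<odot>\<^bsub>B\<^esub> h x"
    using assms(3) by (simp add: alg_hom_def)
qed

section \<open>Monoid algebras\<close>

abbreviation support :: "('g \<Rightarrow> complex) \<Rightarrow> 'g set" where
  "support f \<equiv> {x. f x \<noteq> 0}"

locale monoid_algebra = Group.monoid G for G (structure)
begin

abbreviation "CG \<equiv> monoid_alg G"

lemma carrier_iff: "f \<in> carrier CG \<longleftrightarrow> finite (support f) \<and> support f \<subseteq> carrier G"
  by (simp add: monoid_alg_def)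

lemma one_eq_basis_elt: "\<one>\<^bsub>CG\<^esub> = basis_elt \<one>"
  by (simp add: monoid_alg_def basis_elt_def)

lemma linear_ops:
  "\<zero>\<^bsub>CG\<^esub> = (\<lambda>_. 0)" "f \<oplus>\<^bsub>CG\<^esub> g = (\<lambda>x. f x + g x)" "c \<odot>\<^bsub>CG\<^esub> f = (\<lambda>x. c * f x)"
  by (simp_all add: monoid_alg_def)

lemma basis_elt_closed: "x \<in> carrier G \<Longrightarrow> basis_elt x \<in> carrier CG"
  by (auto simp: carrier_iff basis_elt_def)

lemma mult_eq_sum:
  assumes "finite S" "support f \<subseteq> S" "finite T" "support g \<subseteq> T"
  shows "(f \<otimes>\<^bsub>CG\<^esub> g) z = (\<Sum>x\<in>S. \<Sum>y\<in>T. if x \<otimes> y = z then f x * g y else 0)"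
proof -
  have "(\<Sum>y\<in>support g. if x \<otimes> y = z then f x * g y else 0) =
      (\<Sum>y\<in>T. if x \<otimes> y = z then f x * g y else 0)" for x
    using assms by (intro sum.mono_neutral_left) auto
  moreover have "(\<Sum>x\<in>support f. \<Sum>y\<in>T. if x \<otimes> y = z then f x * g y else 0) =
      (\<Sum>x\<in>S. \<Sum>y\<in>T. if x \<otimes> y = z then f x * g y else 0)"
    using assms by (intro sum.mono_neutral_left) (auto intro!: sum.neutral split: if_splits)
  ultimately show ?thesis
    by (simp add: monoid_alg_def)
qed

lemma basis_elt_mult: "basis_elt x \<otimes>\<^bsub>CG\<^esub> basis_elt y = basis_elt (x \<otimes> y)"
  by (rule ext, subst mult_eq_sum[of "{x}" _ "{y}"]) (auto simp: basis_elt_def)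

lemma support_mult_subset:
  assumes "f \<in> carrier CG" "g \<in> carrier CG"
  shows "support (f \<otimes>\<^bsub>CG\<^esub> g) \<subseteq> support f <#> support g"
proof
  fix z assume "z \<in> support (f \<otimes>\<^bsub>CG\<^esub> g)"
  then have "(\<Sum>x\<in>support f. \<Sum>y\<in>support g. if x \<otimes> y = z then f x * g y else 0) \<noteq> 0"
    using mult_eq_sum[of "support f" f "support g" g z] assms by (simp add: carrier_iff)
  then obtain x y where "x \<in> support f" "y \<in> support g" "(if x \<otimes> y = z then f x * g y else 0) \<noteq> 0"
    by (elim sum.not_neutral_contains_not_neutral) blast
  then show "z \<in> support f <#> support g"
    by (auto simp: set_mult_def split: if_splits)
qed

lemma finite_set_mult: "finite S \<Longrightarrow> finite T \<Longrightarrow> finite (S <#> T)"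
  by (simp add: set_mult_def)

lemma mult_closed:
  assumes "f \<in> carrier CG" "g \<in> carrier CG"
  shows "f \<otimes>\<^bsub>CG\<^esub> g \<in> carrier CG"
proof -
  have "finite (support f <#> support g)" "support f <#> support g \<subseteq> carrier G"
    using assms by (auto simp: carrier_iff set_mult_def subset_iff)
  then show ?thesis
    using support_mult_subset[OF assms] unfolding carrier_iff by (meson finite_subset subset_trans)
qed

lemma sum_mult:
  assumes "f \<in> carrier CG" "g \<in> carrier CG"
  shows "(\<Sum>w\<in>support f <#> support g. (f \<otimes>\<^bsub>CG\<^esub> g) w * \<phi> w) =
    (\<Sum>x\<in>support f. \<Sum>y\<in>support g. f x * g y * \<phi> (x \<otimes> y))"
proof -
  let ?S = "support f" and ?T = "support g"
  have fin: "finite ?S" "finite ?T" "finite (?S <#> ?T)"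
    using assms by (simp_all add: carrier_iff finite_set_mult)
  have "(\<Sum>w\<in>?S <#> ?T. (f \<otimes>\<^bsub>CG\<^esub> g) w * \<phi> w) =
      (\<Sum>w\<in>?S <#> ?T. \<Sum>x\<in>?S. \<Sum>y\<in>?T. if w = x \<otimes> y then f x * g y * \<phi> (x \<otimes> y) else 0)"
    using mult_eq_sum[OF fin(1) subset_refl fin(2) subset_refl]
    by (auto simp: sum_distrib_right intro!: sum.cong)
  also have "\<dots> = (\<Sum>x\<in>?S. \<Sum>y\<in>?T. \<Sum>w\<in>?S <#> ?T. if w = x \<otimes> y then f x * g y * \<phi> (x \<otimes> y) else 0)"
    by (simp only: sum.swap[where A = "?S <#> ?T"])
  also have "\<dots> = (\<Sum>x\<in>?S. \<Sum>y\<in>?T. f x * g y * \<phi> (x \<otimes> y))"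
    using fin by (intro sum.cong refl) (auto simp: set_mult_def)
  finally show ?thesis .
qed

lemma mult_assoc:
  assumes "f \<in> carrier CG" "g \<in> carrier CG" "h \<in> carrier CG"
  shows "f \<otimes>\<^bsub>CG\<^esub> g \<otimes>\<^bsub>CG\<^esub> h = f \<otimes>\<^bsub>CG\<^esub> (g \<otimes>\<^bsub>CG\<^esub> h)"
proof
  fix z :: 'a
  let ?S = "support f" and ?T = "support g" and ?V = "support h"
  let ?\<delta> = "\<lambda>w. if w = z then 1 else 0 :: complex"
  have fin: "finite ?S" "finite ?T" "finite ?V" "finite (?S <#> ?T)" "finite (?T <#> ?V)"
    using assms by (simp_all add: carrier_iff finite_set_mult)
  have "(f \<otimes>\<^bsub>CG\<^esub> g \<otimes>\<^bsub>CG\<^esub> h) z = (\<Sum>w\<in>?S <#> ?T. (f \<otimes>\<^bsub>CG\<^esub> g) w * (\<Sum>v\<in>?V. h v * ?\<delta> (w \<otimes> v)))"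
    using fin support_mult_subset[OF assms(1,2)]
    by (subst mult_eq_sum[of "?S <#> ?T" _ ?V]) (auto simp: sum_distrib_left intro!: sum.cong)
  also have "\<dots> = (\<Sum>x\<in>?S. \<Sum>y\<in>?T. f x * g y * (\<Sum>v\<in>?V. h v * ?\<delta> (x \<otimes> y \<otimes> v)))"
    by (rule sum_mult[OF assms(1,2)])
  also have "\<dots> = (\<Sum>x\<in>?S. f x * (\<Sum>y\<in>?T. \<Sum>v\<in>?V. g y * h v * ?\<delta> (x \<otimes> (y \<otimes> v))))"
    using assms
    by (auto simp: sum_distrib_left carrier_iff subset_iff m_assoc mult.assoc intro!: sum.cong)
  also have "\<dots> = (\<Sum>x\<in>?S. f x * (\<Sum>w\<in>?T <#> ?V. (g \<otimes>\<^bsub>CG\<^esub> h) w * ?\<delta> (x \<otimes> w)))"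
    by (simp only: sum_mult[OF assms(2,3)])
  also have "\<dots> = (f \<otimes>\<^bsub>CG\<^esub> (g \<otimes>\<^bsub>CG\<^esub> h)) z"
    using fin support_mult_subset[OF assms(2,3)]
    by (subst mult_eq_sum[of ?S _ "?T <#> ?V"]) (auto simp: sum_distrib_left intro!: sum.cong)
  finally show "(f \<otimes>\<^bsub>CG\<^esub> g \<otimes>\<^bsub>CG\<^esub> h) z = (f \<otimes>\<^bsub>CG\<^esub> (g \<otimes>\<^bsub>CG\<^esub> h)) z" .
qed

lemma add_closed:
  assumes "f \<in> carrier CG" "g \<in> carrier CG"
  shows "f \<oplus>\<^bsub>CG\<^esub> g \<in> carrier CG"
proof -
  have "support (\<lambda>x. f x + g x) \<subseteq> support f \<union> support g"
    by auto
  then show ?thesis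
    using assms by (auto simp: carrier_iff linear_ops intro: finite_subset)
qed

lemma smult_closed: "f \<in> carrier CG \<Longrightarrow> c \<odot>\<^bsub>CG\<^esub> f \<in> carrier CG"
  by (auto simp: carrier_iff linear_ops intro: finite_subset[of _ "support f"])

lemma mult_distr:
  assumes "f \<in> carrier CG" "g \<in> carrier CG" "h \<in> carrier CG"
  shows "(f \<oplus>\<^bsub>CG\<^esub> g) \<otimes>\<^bsub>CG\<^esub> h = f \<otimes>\<^bsub>CG\<^esub> h \<oplus>\<^bsub>CG\<^esub> g \<otimes>\<^bsub>CG\<^esub> h"
    and "h \<otimes>\<^bsub>CG\<^esub> (f \<oplus>\<^bsub>CG\<^esub> g) = h \<otimes>\<^bsub>CG\<^esub> f \<oplus>\<^bsub>CG\<^esub> h \<otimes>\<^bsub>CG\<^esub> g"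
proof -
  define S where "S = support f \<union> support g \<union> support h"
  have "finite S"
    using assms by (simp add: S_def carrier_iff)
  then have mult: "(k \<otimes>\<^bsub>CG\<^esub> l) z = (\<Sum>x\<in>S. \<Sum>y\<in>S. if x \<otimes> y = z then k x * l y else 0)"
    if "support k \<subseteq> S" "support l \<subseteq> S" for k l z
    using that by (intro mult_eq_sum)
  have supports: "support f \<subseteq> S" "support g \<subseteq> S" "support h \<subseteq> S" "support (\<lambda>x. f x + g x) \<subseteq> S"
    by (auto simp: S_def)
  show "(f \<oplus>\<^bsub>CG\<^esub> g) \<otimes>\<^bsub>CG\<^esub> h = f \<otimes>\<^bsub>CG\<^esub> h \<oplus>\<^bsub>CG\<^esub> g \<otimes>\<^bsub>CG\<^esub> h"
    "h \<otimes>\<^bsub>CG\<^esub> (f \<oplus>\<^bsub>CG\<^esub> g) = h \<otimes>\<^bsub>CG\<^esub> f \<oplus>\<^bsub>CG\<^esub> h \<otimes>\<^bsub>CG\<^esub> g"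
    using supports
    by (auto simp: linear_ops mult fun_eq_iff distrib_left distrib_right simp flip: sum.distrib
        intro!: sum.cong)
qed

lemma smult_mult:
  assumes "f \<in> carrier CG" "g \<in> carrier CG"
  shows "c \<odot>\<^bsub>CG\<^esub> f \<otimes>\<^bsub>CG\<^esub> g = c \<odot>\<^bsub>CG\<^esub> (f \<otimes>\<^bsub>CG\<^esub> g)"
    and "f \<otimes>\<^bsub>CG\<^esub> (c \<odot>\<^bsub>CG\<^esub> g) = c \<odot>\<^bsub>CG\<^esub> (f \<otimes>\<^bsub>CG\<^esub> g)"
proof -
  have mult: "(k \<otimes>\<^bsub>CG\<^esub> l) z = (\<Sum>x\<in>support f. \<Sum>y\<in>support g. if x \<otimes> y = z then k x * l y else 0)"
    if "support k \<subseteq> support f" "support l \<subseteq> support g" for k l z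
    using assms that by (intro mult_eq_sum) (auto simp: carrier_iff)
  have supports: "support (\<lambda>x. c * f x) \<subseteq> support f" "support (\<lambda>x. c * g x) \<subseteq> support g"
    by auto
  show "c \<odot>\<^bsub>CG\<^esub> f \<otimes>\<^bsub>CG\<^esub> g = c \<odot>\<^bsub>CG\<^esub> (f \<otimes>\<^bsub>CG\<^esub> g)" "f \<otimes>\<^bsub>CG\<^esub> (c \<odot>\<^bsub>CG\<^esub> g) = c \<odot>\<^bsub>CG\<^esub> (f \<otimes>\<^bsub>CG\<^esub> g)"
    using supports by (auto simp: linear_ops mult fun_eq_iff sum_distrib_left intro!: sum.cong)
qed

lemma one_mult:
  assumes "f \<in> carrier CG"
  shows "\<one>\<^bsub>CG\<^esub> \<otimes>\<^bsub>CG\<^esub> f = f" and "f \<otimes>\<^bsub>CG\<^esub> \<one>\<^bsub>CG\<^esub> = f"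
proof -
  have fin: "finite (support f)" and carr: "\<And>x. f x \<noteq> 0 \<Longrightarrow> x \<in> carrier G"
    using assms by (auto simp: carrier_iff)
  have "(\<one>\<^bsub>CG\<^esub> \<otimes>\<^bsub>CG\<^esub> f) z = (\<Sum>y\<in>support f. if y = z then f y else 0)" for z
    unfolding one_eq_basis_elt using fin carr
    by (subst mult_eq_sum[of "{\<one>}" _ "support f"]) (auto simp: basis_elt_def intro!: sum.cong)
  moreover have "(f \<otimes>\<^bsub>CG\<^esub> \<one>\<^bsub>CG\<^esub>) z = (\<Sum>x\<in>support f. if x = z then f x else 0)" for z
    unfolding one_eq_basis_elt using fin carr
    by (subst mult_eq_sum[of "support f" _ "{\<one>}"]) (auto simp: basis_elt_def intro!: sum.cong)
  ultimately show "\<one>\<^bsub>CG\<^esub> \<otimes>\<^bsub>CG\<^esub> f = f" "f \<otimes>\<^bsub>CG\<^esub> \<one>\<^bsub>CG\<^esub> = f"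
    using fin by (auto simp: fun_eq_iff)
qed

lemma complex_alg_monoid_alg: "complex_alg CG"
proof (intro complex_alg.intro ringI)
  show "abelian_group CG"
  proof (rule abelian_groupI)
    fix f assume "f \<in> carrier CG"
    then show "\<exists>g\<in>carrier CG. g \<oplus>\<^bsub>CG\<^esub> f = \<zero>\<^bsub>CG\<^esub>"
      using smult_closed[of f "- 1"] by (intro bexI[of _ "(- 1) \<odot>\<^bsub>CG\<^esub> f"]) (auto simp: linear_ops)
  qed (auto simp: add_closed, auto simp: carrier_iff linear_ops algebra_simps)
  show "Group.monoid CG"
    by (rule monoidI)
       (simp_all add: mult_closed mult_assoc one_mult, simp add: one_eq_basis_elt basis_elt_closed)
  show "complex_alg_axioms CG"
    by unfold_locales
       (simp_all add: smult_closed smult_mult, simp_all add: linear_ops algebra_simps)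
qed (simp_all add: mult_distr)

end

section \<open>Quotients\<close>

context complex_alg
begin

lemma carrier_alg_quot: "carrier (alg_quot A I) = (+>) I ` carrier A"
  by (auto simp: alg_quot_def FactRing_simps)

lemma zero_alg_quot: "\<zero>\<^bsub>alg_quot A I\<^esub> = I"
  by (simp add: alg_quot_def FactRing_def)

lemma one_alg_quot: "\<one>\<^bsub>alg_quot A I\<^esub> = I +> \<one>"
  by (simp add: alg_quot_def FactRing_def)

context
  fixes I
  assumes I: "ideal I A"
begin

interpretation I: ideal I A
  by (rule I)

lemma coset_mult:
  assumes "a \<in> carrier A" "b \<in> carrier A"
  shows "(I +> a) \<otimes>\<^bsub>alg_quot A I\<^esub> (I +> b) = I +> a \<otimes> b"
  using ring_hom_mult[OF I.rcos_ring_hom assms] by (simp add: alg_quot_def)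

lemma coset_add:
  assumes "a \<in> carrier A" "b \<in> carrier A"
  shows "(I +> a) \<oplus>\<^bsub>alg_quot A I\<^esub> (I +> b) = I +> a \<oplus> b"
  using ring_hom_add[OF I.rcos_ring_hom assms] by (simp add: alg_quot_def)

lemma coset_smult:
  assumes "a \<in> carrier A"
  shows "c \<odot>\<^bsub>alg_quot A I\<^esub> (I +> a) = I +> c \<odot> a"
proof -
  have "I +> c \<odot> x = I +> c \<odot> a" if "x \<in> I +> a" for x
  proof -
    from that obtain h where h: "h \<in> I" "x = h \<oplus> a"
      by (auto simp: a_r_coset_def')
    then have "c \<odot> x = c \<odot> h \<oplus> c \<odot> a"
      using I.a_Hcarr assms by (simp add: smult_r_distr)
    then have "c \<odot> x \<in> I +> c \<odot> a"
      using ideal_smult_closed[OF I h(1)] by (auto simp: a_r_coset_def')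
    then show ?thesis
      using I.a_repr_independence' assms by simp
  qed
  then have "(\<Union>x\<in>I +> a. I +> c \<odot> x) = I +> c \<odot> a"
    using I.a_rcos_self[OF assms] by blast
  then show ?thesis
    by (simp add: alg_quot_def)
qed

lemma complex_alg_alg_quot: "complex_alg (alg_quot A I)"
proof (rule complex_alg.intro)
  have "(+>) I \<in> ring_hom A (alg_quot A I)"
    using I.rcos_ring_hom
    by (simp add: ring_hom_def carrier_alg_quot coset_mult coset_add one_alg_quot)
  then have "ring (alg_quot A I\<lparr>carrier := (+>) I ` carrier A, zero := I +> \<zero>\<rparr>)"
    by (rule ring_hom_imp_img_ring)
  moreover have "alg_quot A I\<lparr>carrier := (+>) I ` carrier A, zero := I +> \<zero>\<rparr> = alg_quot A I"
    by (auto simp: alg_quot_def FactRing_simps FactRing_def I.a_rcos_const)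
  ultimately show "ring (alg_quot A I)"
    by simp
  show "complex_alg_axioms (alg_quot A I)"
    by (unfold_locales; unfold carrier_alg_quot; elim imageE)
       (simp_all add: coset_smult coset_mult coset_add smult_r_distr smult_l_distr smult_assoc
         smult_mult_left smult_mult_right)
qed

end

end

section \<open>Tensor products\<close>

locale complex_alg_pair = A: complex_alg A + B: complex_alg B
  for A :: "(complex, 'a) module" and B :: "(complex, 'b) module"
begin

abbreviation "F \<equiv> monoid_alg (A \<times>\<times> B)"
abbreviation "T \<equiv> alg_tensor A B"
abbreviation "pure \<equiv> pure_tensor A B"

sublocale pairs: monoid_algebra "A \<times>\<times> B"
  by (rule monoid_algebra.intro[OF DirProd_monoid[OF A.monoid_axioms B.monoid_axioms]])

sublocale F: complex_alg F
  by (rule pairs.complex_alg_monoid_alg)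

lemma basis_elt_pair_closed:
  "a \<in> carrier A \<Longrightarrow> b \<in> carrier B \<Longrightarrow> basis_elt (a, b) \<in> carrier F"
  by (rule pairs.basis_elt_closed) simp

lemma bilinear_rels_closed: "bilinear_rels A B \<subseteq> carrier F"
  unfolding bilinear_rels_def Let_def
  by (auto intro!: F.minus_closed F.a_closed F.smult_closed basis_elt_pair_closed)

lemma ideal_tensor_ideal: "ideal (tensor_ideal A B) F"
  unfolding tensor_ideal_def by (rule F.genideal_ideal[OF bilinear_rels_closed])

sublocale T: complex_alg T
  unfolding alg_tensor_def by (rule F.complex_alg_alg_quot[OF ideal_tensor_ideal])

lemmas tensor_coset_simps =
  basis_elt_pair_closed F.coset_mult[OF ideal_tensor_ideal] F.coset_add[OF ideal_tensor_ideal]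
  F.coset_smult[OF ideal_tensor_ideal]

lemmas tensor_coset_eqI =
  F.coset_eq_if_diff_in_genideal[OF bilinear_rels_closed, folded tensor_ideal_def]

lemma pure_closed [simp, intro]: "a \<in> carrier A \<Longrightarrow> b \<in> carrier B \<Longrightarrow> pure a b \<in> carrier T"
  unfolding pure_tensor_def alg_tensor_def
  by (simp add: F.carrier_alg_quot basis_elt_pair_closed)

lemma pure_mult:
  assumes "a \<in> carrier A" "b \<in> carrier B" "a' \<in> carrier A" "b' \<in> carrier B"
  shows "pure a b \<otimes>\<^bsub>T\<^esub> pure a' b' = pure (a \<otimes>\<^bsub>A\<^esub> a') (b \<otimes>\<^bsub>B\<^esub> b')"
  using assms unfolding pure_tensor_def alg_tensor_def
  by (simp add: tensor_coset_simps pairs.basis_elt_mult)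

lemma one_tensor: "\<one>\<^bsub>T\<^esub> = pure \<one>\<^bsub>A\<^esub> \<one>\<^bsub>B\<^esub>"
  by (simp add: alg_tensor_def pure_tensor_def F.one_alg_quot pairs.one_eq_basis_elt)

lemma bilinear_rels_memI:
  shows "a \<in> carrier A \<Longrightarrow> a' \<in> carrier A \<Longrightarrow> b \<in> carrier B \<Longrightarrow>
      basis_elt (a \<oplus>\<^bsub>A\<^esub> a', b) \<ominus>\<^bsub>F\<^esub> (basis_elt (a, b) \<oplus>\<^bsub>F\<^esub> basis_elt (a', b)) \<in> bilinear_rels A B"
    and "a \<in> carrier A \<Longrightarrow> b \<in> carrier B \<Longrightarrow> b' \<in> carrier B \<Longrightarrow>
      basis_elt (a, b \<oplus>\<^bsub>B\<^esub> b') \<ominus>\<^bsub>F\<^esub> (basis_elt (a, b) \<oplus>\<^bsub>F\<^esub> basis_elt (a, b')) \<in> bilinear_rels A B"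
    and "a \<in> carrier A \<Longrightarrow> b \<in> carrier B \<Longrightarrow>
      basis_elt (c \<odot>\<^bsub>A\<^esub> a, b) \<ominus>\<^bsub>F\<^esub> c \<odot>\<^bsub>F\<^esub> basis_elt (a, b) \<in> bilinear_rels A B"
    and "a \<in> carrier A \<Longrightarrow> b \<in> carrier B \<Longrightarrow>
      basis_elt (a, c \<odot>\<^bsub>B\<^esub> b) \<ominus>\<^bsub>F\<^esub> c \<odot>\<^bsub>F\<^esub> basis_elt (a, b) \<in> bilinear_rels A B"
  unfolding bilinear_rels_def Let_def by blast+

lemma pure_add_left:
  assumes "a \<in> carrier A" "a' \<in> carrier A" "b \<in> carrier B"
  shows "pure (a \<oplus>\<^bsub>A\<^esub> a') b = pure a b \<oplus>\<^bsub>T\<^esub> pure a' b"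
  using tensor_coset_eqI[OF bilinear_rels_memI(1)[OF assms]] assms
  unfolding pure_tensor_def alg_tensor_def by (simp add: tensor_coset_simps)

lemma pure_add_right:
  assumes "a \<in> carrier A" "b \<in> carrier B" "b' \<in> carrier B"
  shows "pure a (b \<oplus>\<^bsub>B\<^esub> b') = pure a b \<oplus>\<^bsub>T\<^esub> pure a b'"
  using tensor_coset_eqI[OF bilinear_rels_memI(2)[OF assms]] assms
  unfolding pure_tensor_def alg_tensor_def by (simp add: tensor_coset_simps)

lemma pure_smult_left:
  assumes "a \<in> carrier A" "b \<in> carrier B"
  shows "pure (c \<odot>\<^bsub>A\<^esub> a) b = c \<odot>\<^bsub>T\<^esub> pure a b"
  using tensor_coset_eqI[OF bilinear_rels_memI(3)[OF assms, of c]] assms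
  unfolding pure_tensor_def alg_tensor_def by (simp add: tensor_coset_simps)

lemma pure_smult_right:
  assumes "a \<in> carrier A" "b \<in> carrier B"
  shows "pure a (c \<odot>\<^bsub>B\<^esub> b) = c \<odot>\<^bsub>T\<^esub> pure a b"
  using tensor_coset_eqI[OF bilinear_rels_memI(4)[OF assms, of c]] assms
  unfolding pure_tensor_def alg_tensor_def by (simp add: tensor_coset_simps)

lemma pure_zero_left: "b \<in> carrier B \<Longrightarrow> pure \<zero>\<^bsub>A\<^esub> b = \<zero>\<^bsub>T\<^esub>"
  using pure_smult_left[of "\<zero>\<^bsub>A\<^esub>" b 0] by (simp add: T.smult_zero_left)

lemma pure_zero_right: "a \<in> carrier A \<Longrightarrow> pure a \<zero>\<^bsub>B\<^esub> = \<zero>\<^bsub>T\<^esub>"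
  using pure_smult_right[of a "\<zero>\<^bsub>B\<^esub>" 0] by (simp add: T.smult_zero_left)

lemma inv_pure:
  assumes "a \<in> Units A" "b \<in> Units B"
  shows "inv\<^bsub>T\<^esub> (pure a b) = pure (inv\<^bsub>A\<^esub> a) (inv\<^bsub>B\<^esub> b)"
  using assms
  by (intro T.inv_unique'[symmetric])
     (simp_all add: pure_mult one_tensor A.Units_closed B.Units_closed)

lemma alg_hom_pure_left: "(\<lambda>a. pure a \<one>\<^bsub>B\<^esub>) \<in> alg_hom A T"
  by (auto simp: alg_hom_def ring_hom_def pure_mult pure_add_left pure_smult_left one_tensor)

lemma alg_hom_pure_right: "(\<lambda>b. pure \<one>\<^bsub>A\<^esub> b) \<in> alg_hom B T"
  by (auto simp: alg_hom_def ring_hom_def pure_mult pure_add_right pure_smult_right one_tensor)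

end

section \<open>Subalgebras\<close>

lemma is_subalgE:
  assumes "is_subalg Z A"
  shows "Z \<subseteq> carrier A" and "\<zero>\<^bsub>A\<^esub> \<in> Z" and "\<one>\<^bsub>A\<^esub> \<in> Z"
    and "\<And>x y. x \<in> Z \<Longrightarrow> y \<in> Z \<Longrightarrow> x \<otimes>\<^bsub>A\<^esub> y \<in> Z"
    and "\<And>x y. x \<in> Z \<Longrightarrow> y \<in> Z \<Longrightarrow> x \<oplus>\<^bsub>A\<^esub> y \<in> Z"
    and "\<And>c x. x \<in> Z \<Longrightarrow> c \<odot>\<^bsub>A\<^esub> x \<in> Z"
  using assms subringE[of Z A] by (auto simp: is_subalg_def)

lemma subalg_gen_superset: "X \<subseteq> subalg_gen A X"
  by (auto simp: subalg_gen_def)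

lemma subalg_gen_minimal: "is_subalg Z A \<Longrightarrow> X \<subseteq> Z \<Longrightarrow> subalg_gen A X \<subseteq> Z"
  by (auto simp: subalg_gen_def)

context complex_alg
begin

lemma is_subalgI:
  assumes "Z \<subseteq> carrier A" "\<one> \<in> Z"
    and "\<And>x y. x \<in> Z \<Longrightarrow> y \<in> Z \<Longrightarrow> x \<otimes> y \<in> Z"
    and "\<And>x y. x \<in> Z \<Longrightarrow> y \<in> Z \<Longrightarrow> x \<oplus> y \<in> Z"
    and smult: "\<And>c x. x \<in> Z \<Longrightarrow> c \<odot> x \<in> Z"
  shows "is_subalg Z A"
proof -
  have "\<ominus> x \<in> Z" if "x \<in> Z" for x
    using smult[OF that, of "- 1"] that assms(1) by (auto simp: smult_minus_one)
  then show ?thesis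
    using assms subringI by (auto simp: is_subalg_def)
qed

lemma is_subalg_carrier: "is_subalg (carrier A) A"
  by (rule is_subalgI) auto

lemma is_subalg_subalg_gen:
  assumes "X \<subseteq> carrier A"
  shows "is_subalg (subalg_gen A X) A"
proof -
  have "subring (subalg_gen A X) A"
    unfolding subalg_gen_def
    using is_subalg_carrier assms by (intro subring_Inter) (auto simp: is_subalg_def)
  then show ?thesis
    by (auto simp: is_subalg_def subalg_gen_def)
qed

lemma subalg_finsum_closed:
  assumes "is_subalg Z A" "\<And>i. i \<in> I \<Longrightarrow> f i \<in> Z"
  shows "(\<Oplus>i\<in>I. f i) \<in> Z"
  using assms(2)
proof (induction I rule: infinite_finite_induct)
  case (insert i I)
  then have "(\<Oplus>i\<in>insert i I. f i) = f i \<oplus> (\<Oplus>i\<in>I. f i)"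
    using is_subalgE(1)[OF assms(1)] by (intro finsum_insert) auto
  then show ?case
    using insert is_subalgE(5)[OF assms(1)] by simp
qed (simp_all add: is_subalgE(2)[OF assms(1)])

end

lemma is_subalg_vimage:
  assumes "complex_alg A" "complex_alg B" "h \<in> alg_hom A B" "is_subalg Z B"
  shows "is_subalg {x \<in> carrier A. h x \<in> Z} A"
proof -
  interpret A: complex_alg A by fact
  interpret h: ring_hom_ring A B h
    by (rule alg_homD(1)[OF assms(1-3)])
  show ?thesis
    by (rule A.is_subalgI) (auto simp: is_subalgE[OF assms(4)] alg_homD(2)[OF assms(1-3)])
qed

context complex_alg_pair
begin

context
  fixes X Z
  assumes X: "X \<subseteq> carrier A" and Z: "Z \<subseteq> carrier B"
begin

lemma zero_in_sub_tensor: "\<zero>\<^bsub>T\<^esub> \<in> sub_tensor A B X Z"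
proof -
  have "\<zero>\<^bsub>T\<^esub> = (\<Oplus>\<^bsub>T\<^esub>i\<in>{..<0::nat}. pure (undefined i) (undefined i))"
    by simp
  then show ?thesis
    unfolding sub_tensor_def by blast
qed

lemma sub_tensor_add_pure:
  assumes "x \<in> sub_tensor A B X Z" "a \<in> X" "b \<in> Z"
  shows "x \<oplus>\<^bsub>T\<^esub> pure a b \<in> sub_tensor A B X Z"
proof -
  from assms(1) obtain m u v where x: "x = (\<Oplus>\<^bsub>T\<^esub>i\<in>{..<m::nat}. pure (u i) (v i))"
    and uv: "\<forall>i<m. u i \<in> X \<and> v i \<in> Z"
    unfolding sub_tensor_def by blast
  let ?u = "u(m := a)" and ?v = "v(m := b)"
  have mem: "\<forall>i<Suc m. ?u i \<in> X \<and> ?v i \<in> Z"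
    using uv assms(2,3) by (auto simp: less_Suc_eq)
  then have closed: "pure (?u i) (?v i) \<in> carrier T" if "i < Suc m" for i
    using that X Z by blast
  have "x = (\<Oplus>\<^bsub>T\<^esub>i\<in>{..<m}. pure (?u i) (?v i))"
    unfolding x using uv X Z by (intro T.finsum_cong') (auto simp: subset_iff)
  then have "x \<oplus>\<^bsub>T\<^esub> pure a b = (\<Oplus>\<^bsub>T\<^esub>i\<in>{..<Suc m}. pure (?u i) (?v i))"
    using T.finsum_lessThan_Suc[of m "\<lambda>i. pure (?u i) (?v i)"] closed by simp
  then show ?thesis
    unfolding sub_tensor_def using mem by blast
qed

lemma sub_tensor_induct [consumes 1, case_names zero add_pure]:
  assumes "x \<in> sub_tensor A B X Z" "P \<zero>\<^bsub>T\<^esub>"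
    and add_pure: "\<And>x a b. x \<in> carrier T \<Longrightarrow> P x \<Longrightarrow> a \<in> X \<Longrightarrow> b \<in> Z \<Longrightarrow> P (x \<oplus>\<^bsub>T\<^esub> pure a b)"
  shows "P x"
proof -
  from assms(1) obtain m u v where x: "x = (\<Oplus>\<^bsub>T\<^esub>i\<in>{..<m::nat}. pure (u i) (v i))"
    and uv: "\<forall>i<m. u i \<in> X \<and> v i \<in> Z"
    unfolding sub_tensor_def by blast
  from uv show ?thesis
    unfolding x
  proof (induction m)
    case (Suc m)
    then have closed: "pure (u i) (v i) \<in> carrier T" if "i < Suc m" for i
      using that X Z by blast
    then have "(\<Oplus>\<^bsub>T\<^esub>i\<in>{..<Suc m}. pure (u i) (v i)) =
        (\<Oplus>\<^bsub>T\<^esub>i\<in>{..<m}. pure (u i) (v i)) \<oplus>\<^bsub>T\<^esub> pure (u m) (v m)"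
      by (rule T.finsum_lessThan_Suc)
    moreover have "(\<Oplus>\<^bsub>T\<^esub>i\<in>{..<m}. pure (u i) (v i)) \<in> carrier T"
      using closed by (intro T.finsum_closed) auto
    ultimately show ?case
      using Suc add_pure by simp
  qed (simp add: assms(2))
qed

lemma pure_in_sub_tensor:
  assumes "a \<in> X" "b \<in> Z"
  shows "pure a b \<in> sub_tensor A B X Z"
  using sub_tensor_add_pure[OF zero_in_sub_tensor assms] assms X Z by (simp add: subset_iff)

lemma sub_tensor_subset: "sub_tensor A B X Z \<subseteq> carrier T"
proof
  fix x assume "x \<in> sub_tensor A B X Z"
  then show "x \<in> carrier T"
    using X Z by (induction rule: sub_tensor_induct) auto
qed

lemma sub_tensor_add:
  assumes "x \<in> sub_tensor A B X Z" "y \<in> sub_tensor A B X Z"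
  shows "x \<oplus>\<^bsub>T\<^esub> y \<in> sub_tensor A B X Z"
  using assms(2)
proof (induction rule: sub_tensor_induct)
  case zero
  then show ?case
    using assms(1) sub_tensor_subset by auto
next
  case (add_pure y a b)
  have "x \<oplus>\<^bsub>T\<^esub> (y \<oplus>\<^bsub>T\<^esub> pure a b) = x \<oplus>\<^bsub>T\<^esub> y \<oplus>\<^bsub>T\<^esub> pure a b"
    using assms(1) add_pure X Z sub_tensor_subset by (intro T.a_assoc[symmetric]) auto
  then show ?case
    using add_pure by (simp add: sub_tensor_add_pure)
qed

end

lemma is_subalg_sub_tensor:
  assumes "is_subalg X A" "is_subalg Z B"
  shows "is_subalg (sub_tensor A B X Z) T"
proof -
  note X = is_subalgE[OF assms(1)] and Z = is_subalgE[OF assms(2)]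
  note induct = sub_tensor_induct[OF X(1) Z(1), consumes 1, case_names zero add_pure]
  note zero = zero_in_sub_tensor[OF X(1) Z(1)] and add = sub_tensor_add[OF X(1) Z(1)]
    and pure = pure_in_sub_tensor[OF X(1) Z(1)] and subset = sub_tensor_subset[OF X(1) Z(1)]
  let ?S = "sub_tensor A B X Z"
  have closed: "a \<in> carrier A" "b \<in> carrier B" if "a \<in> X" "b \<in> Z" for a b
    using that X(1) Z(1) by auto
  have pure_mult_mem: "pure a b \<otimes>\<^bsub>T\<^esub> y \<in> ?S" if "a \<in> X" "b \<in> Z" "y \<in> ?S" for a b y
    using that(3)
  proof (induction rule: induct)
    case (add_pure y a' b')
    then show ?case
      using that(1,2) closed X(4) Z(4) by (simp add: T.r_distr pure_mult add pure)
  qed (use that closed zero in simp)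
  have mult: "x \<otimes>\<^bsub>T\<^esub> y \<in> ?S" if "x \<in> ?S" "y \<in> ?S" for x y
    using that(1)
  proof (induction rule: induct)
    case (add_pure x a b)
    then have "(x \<oplus>\<^bsub>T\<^esub> pure a b) \<otimes>\<^bsub>T\<^esub> y = x \<otimes>\<^bsub>T\<^esub> y \<oplus>\<^bsub>T\<^esub> pure a b \<otimes>\<^bsub>T\<^esub> y"
      using that(2) subset closed by (intro T.l_distr) auto
    then show ?case
      using add_pure that(2) pure_mult_mem add by simp
  qed (use that(2) subset zero in auto)
  have smult: "c \<odot>\<^bsub>T\<^esub> x \<in> ?S" if "x \<in> ?S" for c x
    using that
  proof (induction rule: induct)
    case (add_pure x a b)
    then show ?case
      using closed X(6) by (simp add: T.smult_r_distr add pure flip: pure_smult_left)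
  qed (simp add: zero)
  have "\<one>\<^bsub>T\<^esub> \<in> ?S"
    using X(3) Z(3) by (simp add: one_tensor pure)
  then show ?thesis
    using subset mult add smult by (intro T.is_subalgI)
qed

end

section \<open>Formal series\<close>

lemma series_ring_simps:
  "f \<in> carrier (series_ring A) \<longleftrightarrow> (\<forall>r. f r \<in> carrier A)"
  "f \<otimes>\<^bsub>series_ring A\<^esub> g = (\<lambda>r. \<Oplus>\<^bsub>A\<^esub>a\<in>{..r}. f a \<otimes>\<^bsub>A\<^esub> g (r - a))"
  "\<one>\<^bsub>series_ring A\<^esub> = (\<lambda>r. if r = 0 then \<one>\<^bsub>A\<^esub> else \<zero>\<^bsub>A\<^esub>)"
  "\<zero>\<^bsub>series_ring A\<^esub> = (\<lambda>_. \<zero>\<^bsub>A\<^esub>)"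
  "f \<oplus>\<^bsub>series_ring A\<^esub> g = (\<lambda>r. f r \<oplus>\<^bsub>A\<^esub> g r)"
  by (simp_all add: series_ring_def)

context complex_alg
begin

abbreviation "SA \<equiv> series_ring A"

lemma series_mult_closed: "f \<in> carrier SA \<Longrightarrow> g \<in> carrier SA \<Longrightarrow> f \<otimes>\<^bsub>SA\<^esub> g \<in> carrier SA"
  by (auto simp: series_ring_simps)

text \<open>
  Coefficients up to order \<open>n\<close> of a product depend only on coefficients up to order \<open>n\<close> of the
  factors, so associativity is inherited from polynomials.
\<close>

lemma series_mult_assoc:
  assumes "f \<in> carrier SA" "g \<in> carrier SA" "h \<in> carrier SA"
  shows "f \<otimes>\<^bsub>SA\<^esub> g \<otimes>\<^bsub>SA\<^esub> h = f \<otimes>\<^bsub>SA\<^esub> (g \<otimes>\<^bsub>SA\<^esub> h)"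
proof
  fix n
  interpret P: UP_ring A "UP A"
    by unfold_locales simp
  define trunc where "trunc k = (\<lambda>r. if r \<le> n then k r else \<zero>)" for k :: "nat \<Rightarrow> 'a"
  have trunc_closed: "trunc k \<in> carrier (UP A)" if "k \<in> carrier SA" for k
    using that by (auto simp: UP_def trunc_def series_ring_simps intro!: mem_upI exI[of _ n])
  have mult_coeff: "(p \<otimes>\<^bsub>UP A\<^esub> p') r = (k \<otimes>\<^bsub>SA\<^esub> k') r"
    if "p \<in> carrier (UP A)" "p' \<in> carrier (UP A)" "k \<in> carrier SA" "k' \<in> carrier SA"
      and "\<And>s. s \<le> n \<Longrightarrow> p s = k s" "\<And>s. s \<le> n \<Longrightarrow> p' s = k' s" and "r \<le> n" for p p' k k' r
    using that by (auto simp: UP_def series_ring_simps intro!: finsum_cong')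
  have trunc_mult: "(trunc k \<otimes>\<^bsub>UP A\<^esub> trunc k') r = (k \<otimes>\<^bsub>SA\<^esub> k') r"
    if "k \<in> carrier SA" "k' \<in> carrier SA" "r \<le> n" for k k' r
    using that by (intro mult_coeff trunc_closed) (auto simp: trunc_def)
  have "(f \<otimes>\<^bsub>SA\<^esub> g \<otimes>\<^bsub>SA\<^esub> h) n = (trunc f \<otimes>\<^bsub>UP A\<^esub> trunc g \<otimes>\<^bsub>UP A\<^esub> trunc h) n"
    using assms trunc_closed
    by (intro mult_coeff[symmetric] series_mult_closed P.UP_mult_closed trunc_mult)
       (auto simp: trunc_def)
  also have "\<dots> = (trunc f \<otimes>\<^bsub>UP A\<^esub> (trunc g \<otimes>\<^bsub>UP A\<^esub> trunc h)) n"
    using assms trunc_closed by (simp add: P.UP_m_assoc)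
  also have "\<dots> = (f \<otimes>\<^bsub>SA\<^esub> (g \<otimes>\<^bsub>SA\<^esub> h)) n"
    using assms trunc_closed
    by (intro mult_coeff series_mult_closed P.UP_mult_closed trunc_mult) (auto simp: trunc_def)
  finally show "(f \<otimes>\<^bsub>SA\<^esub> g \<otimes>\<^bsub>SA\<^esub> h) n = (f \<otimes>\<^bsub>SA\<^esub> (g \<otimes>\<^bsub>SA\<^esub> h)) n" .
qed

lemma series_mult_commute:
  assumes "f \<in> carrier SA" "g \<in> carrier SA" "\<And>a b. f a \<otimes> g b = g b \<otimes> f a"
  shows "f \<otimes>\<^bsub>SA\<^esub> g = g \<otimes>\<^bsub>SA\<^esub> f"
proof
  fix r :: nat
  have closed: "f a \<in> carrier A" "g a \<in> carrier A" for a
    using assms by (simp_all add: series_ring_simps)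
  have "bij_betw (\<lambda>a. r - a) {..r} {..r}"
    by (rule bij_betw_byWitness[where f' = "\<lambda>a. r - a"]) auto
  then have reflect: "inj_on (\<lambda>a. r - a) {..r}" "(\<lambda>a. r - a) ` {..r} = {..r}"
    by (auto simp: bij_betw_def)
  have "(f \<otimes>\<^bsub>SA\<^esub> g) r = (\<Oplus>a\<in>(\<lambda>a. r - a) ` {..r}. g (r - a) \<otimes> f a)"
    by (simp add: reflect(2) series_ring_simps assms(3))
  also have "\<dots> = (\<Oplus>a\<in>{..r}. g (r - (r - a)) \<otimes> f (r - a))"
    using closed reflect(1) by (intro add.finprod_reindex) auto
  also have "\<dots> = (g \<otimes>\<^bsub>SA\<^esub> f) r"
    unfolding series_ring_simps using closed by (intro finsum_cong') auto
  finally show "(f \<otimes>\<^bsub>SA\<^esub> g) r = (g \<otimes>\<^bsub>SA\<^esub> f) r" .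
qed

lemma series_mult_one:
  assumes "f \<in> carrier SA"
  shows "f \<otimes>\<^bsub>SA\<^esub> \<one>\<^bsub>SA\<^esub> = f" and "\<one>\<^bsub>SA\<^esub> \<otimes>\<^bsub>SA\<^esub> f = f"
proof -
  have closed: "f a \<in> carrier A" for a
    using assms by (simp add: series_ring_simps)
  have "(f \<otimes>\<^bsub>SA\<^esub> \<one>\<^bsub>SA\<^esub>) r = f r" for r
    using closed finsum_eq_single[of "{..r}" r "\<lambda>a. f a \<otimes> \<one>\<^bsub>SA\<^esub> (r - a)"]
    by (simp add: series_ring_simps)
  then show one_right: "f \<otimes>\<^bsub>SA\<^esub> \<one>\<^bsub>SA\<^esub> = f" ..
  have "\<one>\<^bsub>SA\<^esub> \<otimes>\<^bsub>SA\<^esub> f = f \<otimes>\<^bsub>SA\<^esub> \<one>\<^bsub>SA\<^esub>"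
    using closed by (intro series_mult_commute) (auto simp: series_ring_simps)
  then show "\<one>\<^bsub>SA\<^esub> \<otimes>\<^bsub>SA\<^esub> f = f"
    by (simp add: one_right)
qed

sublocale SA: ring SA
proof (rule ringI)
  show "abelian_group SA"
  proof (rule abelian_groupI)
    fix f assume "f \<in> carrier SA"
    then show "\<exists>g\<in>carrier SA. g \<oplus>\<^bsub>SA\<^esub> f = \<zero>\<^bsub>SA\<^esub>"
      by (intro bexI[of _ "\<lambda>r. \<ominus> f r"]) (auto simp: series_ring_simps l_neg)
  qed (auto simp: series_ring_simps a_ac)
  show "Group.monoid SA"
    by (rule monoidI)
       (simp_all add: series_mult_closed series_mult_assoc series_mult_one,
        simp add: series_ring_simps)
qed (auto simp: series_ring_simps l_distr r_distr finsum_addf Pi_def cong: finsum_cong)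

lemma coeff_0_hom: "ring_hom_ring SA A (\<lambda>f. f 0)"
  by (rule ring_hom_ringI[OF SA.ring_axioms ring_axioms]) (simp_all add: series_ring_simps)

lemma finsum_series_nth:
  assumes "\<And>i. i \<in> I \<Longrightarrow> f i \<in> carrier SA"
  shows "(\<Oplus>\<^bsub>SA\<^esub>i\<in>I. f i) r = (\<Oplus>i\<in>I. f i r)"
  using assms
proof (induction I rule: infinite_finite_induct)
  case (insert i I)
  then have "f j r \<in> carrier A" if "j \<in> insert i I" for j
    using that by (simp add: series_ring_simps)
  moreover have "(\<Oplus>\<^bsub>SA\<^esub>i\<in>insert i I. f i) = f i \<oplus>\<^bsub>SA\<^esub> (\<Oplus>\<^bsub>SA\<^esub>i\<in>I. f i)"
    using insert by (intro SA.finsum_insert) auto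
  ultimately show ?case
    using insert by (simp add: series_ring_simps)
qed (simp_all add: series_ring_simps)

lemma subalg_finsum_series_closed:
  assumes "is_subalg Z A" "\<And>i r. i \<in> I \<Longrightarrow> f i r \<in> Z"
  shows "(\<Oplus>\<^bsub>SA\<^esub>i\<in>I. f i) r \<in> Z"
proof -
  have "(\<Oplus>\<^bsub>SA\<^esub>i\<in>I. f i) r = (\<Oplus>i\<in>I. f i r)"
    using assms(2) is_subalgE(1)[OF assms(1)]
    by (intro finsum_series_nth) (auto simp: series_ring_simps)
  then show ?thesis
    using subalg_finsum_closed[OF assms] by simp
qed

lemma const_series_closed: "const_series A c \<in> carrier SA"
  by (simp add: series_ring_simps const_series_def)

end

lemma alg_hom_series:
  assumes "complex_alg A" "complex_alg B" "h \<in> alg_hom A B"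
  shows "ring_hom_ring (series_ring A) (series_ring B) (\<lambda>f r. h (f r))"
proof -
  interpret A: complex_alg A by fact
  interpret B: complex_alg B by fact
  interpret h: ring_hom_ring A B h
    by (rule alg_homD(1)[OF assms])
  show ?thesis
    by (rule ring_hom_ringI[OF A.SA.ring_axioms B.SA.ring_axioms])
       (auto simp: series_ring_simps fun_eq_iff Pi_def o_def intro!: B.finsum_cong')
qed

lemma alg_hom_const_series:
  assumes "complex_alg A" "complex_alg B" "h \<in> alg_hom A B"
  shows "(\<lambda>r. h (const_series A c r)) = const_series B c"
proof -
  interpret A: complex_alg A by fact
  interpret h: ring_hom_ring A B h
    by (rule alg_homD(1)[OF assms])
  show ?thesis
    by (auto simp: const_series_def alg_homD(2)[OF assms])
qed

section \<open>Matrices over a ring\<close>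

definition mat_carrier :: "('a, 'm) ring_scheme \<Rightarrow> nat \<Rightarrow> 'a mat set" where
  "mat_carrier R N = {M. \<forall>i\<in>{1..N}. \<forall>j\<in>{1..N}. M i j \<in> carrier R}"

definition mat_eq :: "nat \<Rightarrow> 'a mat \<Rightarrow> 'a mat \<Rightarrow> bool" where
  "mat_eq N M M' \<longleftrightarrow> (\<forall>i\<in>{1..N}. \<forall>j\<in>{1..N}. M i j = M' i j)"

definition map_mat :: "('a \<Rightarrow> 'b) \<Rightarrow> 'a mat \<Rightarrow> 'b mat" where
  "map_mat h M = (\<lambda>i j. h (M i j))"

lemma mat_eqD: "mat_eq N M M' \<Longrightarrow> i \<in> {1..N} \<Longrightarrow> j \<in> {1..N} \<Longrightarrow> M i j = M' i j"
  by (simp add: mat_eq_def)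

lemma mat_eq_refl [simp]: "mat_eq N M M"
  by (simp add: mat_eq_def)

lemma mat_eq_sym: "mat_eq N M M' \<Longrightarrow> mat_eq N M' M"
  by (simp add: mat_eq_def)

lemma mat_eq_trans [trans]: "mat_eq N M M' \<Longrightarrow> mat_eq N M' M'' \<Longrightarrow> mat_eq N M M''"
  by (simp add: mat_eq_def)

lemma mat_carrierD: "M \<in> mat_carrier R N \<Longrightarrow> i \<in> {1..N} \<Longrightarrow> j \<in> {1..N} \<Longrightarrow> M i j \<in> carrier R"
  by (simp add: mat_carrier_def)

lemma mat_transpose_closed: "M \<in> mat_carrier R N \<Longrightarrow> mat_transpose M \<in> mat_carrier R N"
  by (simp add: mat_carrier_def mat_transpose_def)

lemma mat_eq_transpose: "mat_eq N M M' \<Longrightarrow> mat_eq N (mat_transpose M) (mat_transpose M')"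
  by (simp add: mat_eq_def mat_transpose_def)

lemma map_mat_transpose: "map_mat h (mat_transpose M) = mat_transpose (map_mat h M)"
  by (simp add: map_mat_def mat_transpose_def)

context ring
begin

lemma mat_prod_closed:
  "M \<in> mat_carrier R N \<Longrightarrow> M' \<in> mat_carrier R N \<Longrightarrow> mat_prod R N M M' \<in> mat_carrier R N"
  by (auto simp: mat_carrier_def mat_prod_def intro!: finsum_closed)

lemma mat_prod_cong:
  assumes "mat_eq N M K" "mat_eq N M' K'" "K \<in> mat_carrier R N" "K' \<in> mat_carrier R N"
  shows "mat_eq N (mat_prod R N M M') (mat_prod R N K K')"
  using assms by (auto simp: mat_eq_def mat_carrier_def mat_prod_def intro!: finsum_cong')

lemma mat_prod_assoc:
  assumes "A \<in> mat_carrier R N" "B \<in> mat_carrier R N" "C \<in> mat_carrier R N"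
  shows "mat_eq N (mat_prod R N (mat_prod R N A B) C) (mat_prod R N A (mat_prod R N B C))"
  unfolding mat_eq_def
proof (intro ballI)
  fix i j assume ij: "i \<in> {1..N}" "j \<in> {1..N}"
  note closed = mat_carrierD[OF assms(1)] mat_carrierD[OF assms(2)] mat_carrierD[OF assms(3)]
  have "mat_prod R N (mat_prod R N A B) C i j = (\<Oplus>l\<in>{1..N}. \<Oplus>k\<in>{1..N}. A i k \<otimes> B k l \<otimes> C l j)"
    unfolding mat_prod_def using ij closed
    by (intro finsum_cong' finsum_ldistr) (auto intro!: finsum_closed)
  also have "\<dots> = (\<Oplus>k\<in>{1..N}. \<Oplus>l\<in>{1..N}. A i k \<otimes> B k l \<otimes> C l j)"
    using ij closed by (intro finsum_swap) auto
  also have "\<dots> = (\<Oplus>k\<in>{1..N}. \<Oplus>l\<in>{1..N}. A i k \<otimes> (B k l \<otimes> C l j))"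
    using ij closed by (intro finsum_cong' refl) (auto simp: m_assoc intro!: finsum_closed)
  also have "\<dots> = mat_prod R N A (mat_prod R N B C) i j"
    unfolding mat_prod_def using ij closed
    by (intro finsum_cong' finsum_rdistr[symmetric]) (auto intro!: finsum_closed)
  finally show "mat_prod R N (mat_prod R N A B) C i j = mat_prod R N A (mat_prod R N B C) i j" .
qed

end

context ring_hom_ring
begin

lemma map_mat_closed: "M \<in> mat_carrier R N \<Longrightarrow> map_mat h M \<in> mat_carrier S N"
  by (simp add: mat_carrier_def map_mat_def)

lemma hom_mat_prod:
  assumes "M \<in> mat_carrier R N" "M' \<in> mat_carrier R N"
  shows "mat_eq N (map_mat h (mat_prod R N M M')) (mat_prod S N (map_mat h M) (map_mat h M'))"
  using assms
  by (auto simp: mat_eq_def map_mat_def mat_prod_def mat_carrier_def Pi_def intro!: S.finsum_cong')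

lemma hom_mat_prod3:
  assumes "M \<in> mat_carrier R N" "M' \<in> mat_carrier R N" "M'' \<in> mat_carrier R N"
  shows "mat_eq N (map_mat h (mat_prod R N (mat_prod R N M M') M''))
    (mat_prod S N (mat_prod S N (map_mat h M) (map_mat h M')) (map_mat h M''))"
proof -
  have "mat_eq N (map_mat h (mat_prod R N (mat_prod R N M M') M''))
      (mat_prod S N (map_mat h (mat_prod R N M M')) (map_mat h M''))"
    using assms by (intro hom_mat_prod R.mat_prod_closed)
  also have "mat_eq N \<dots> (mat_prod S N (mat_prod S N (map_mat h M) (map_mat h M')) (map_mat h M''))"
    using assms by (intro S.mat_prod_cong hom_mat_prod mat_eq_refl S.mat_prod_closed map_mat_closed)
  finally show ?thesis .
qed

end

locale commuting_ring_homs = L: ring_hom_ring A T L + R: ring_hom_ring B T R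
  for A :: "('a, 'm) ring_scheme" and B :: "('b, 'n) ring_scheme" and T :: "('c, 'p) ring_scheme"
    and L R +
  assumes commute: "a \<in> carrier A \<Longrightarrow> b \<in> carrier B \<Longrightarrow> L a \<otimes>\<^bsub>T\<^esub> R b = R b \<otimes>\<^bsub>T\<^esub> L a"
begin

lemma transpose_mat_prod:
  assumes "M \<in> mat_carrier A N" "M' \<in> mat_carrier B N"
  shows "mat_eq N (mat_transpose (mat_prod T N (map_mat L M) (map_mat R M')))
    (mat_prod T N (map_mat R (mat_transpose M')) (map_mat L (mat_transpose M)))"
  using assms
  by (auto simp: mat_eq_def mat_transpose_def mat_prod_def map_mat_def mat_carrier_def commute
      intro!: L.S.finsum_cong')

lemma mat_prod_left_right_left:
  assumes "X \<in> mat_carrier A N" "S \<in> mat_carrier B N" "Y \<in> mat_carrier A N"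
    and "i \<in> {1..N}" "j \<in> {1..N}"
  shows "mat_prod T N (mat_prod T N (map_mat L X) (map_mat R S)) (map_mat L (mat_transpose Y)) i j =
    (\<Oplus>\<^bsub>T\<^esub>k\<in>{1..N}. \<Oplus>\<^bsub>T\<^esub>l\<in>{1..N}. L (X i k \<otimes>\<^bsub>A\<^esub> Y j l) \<otimes>\<^bsub>T\<^esub> R (S k l))"
proof -
  note closed = mat_carrierD[OF assms(1)] mat_carrierD[OF assms(2)] mat_carrierD[OF assms(3)]
  have regroup: "L (X i k) \<otimes>\<^bsub>T\<^esub> R (S k l) \<otimes>\<^bsub>T\<^esub> L (Y j l) = L (X i k \<otimes>\<^bsub>A\<^esub> Y j l) \<otimes>\<^bsub>T\<^esub> R (S k l)"
    if "k \<in> {1..N}" "l \<in> {1..N}" for k l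
  proof -
    have closed_kl: "X i k \<in> carrier A" "S k l \<in> carrier B" "Y j l \<in> carrier A"
      using closed assms(4,5) that by blast+
    then have "L (X i k) \<otimes>\<^bsub>T\<^esub> R (S k l) \<otimes>\<^bsub>T\<^esub> L (Y j l) = L (X i k) \<otimes>\<^bsub>T\<^esub> (L (Y j l) \<otimes>\<^bsub>T\<^esub> R (S k l))"
      by (simp add: L.S.m_assoc commute[of "Y j l"])
    then show ?thesis
      using closed_kl by (simp add: L.S.m_assoc)
  qed
  have "mat_prod T N (mat_prod T N (map_mat L X) (map_mat R S)) (map_mat L (mat_transpose Y)) i j =
      (\<Oplus>\<^bsub>T\<^esub>l\<in>{1..N}. \<Oplus>\<^bsub>T\<^esub>k\<in>{1..N}. L (X i k) \<otimes>\<^bsub>T\<^esub> R (S k l) \<otimes>\<^bsub>T\<^esub> L (Y j l))"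
    unfolding mat_prod_def map_mat_def mat_transpose_def using assms(4,5) closed
    by (intro L.S.finsum_cong' L.S.finsum_ldistr) (auto intro!: L.S.finsum_closed)
  also have "\<dots> = (\<Oplus>\<^bsub>T\<^esub>k\<in>{1..N}. \<Oplus>\<^bsub>T\<^esub>l\<in>{1..N}. L (X i k) \<otimes>\<^bsub>T\<^esub> R (S k l) \<otimes>\<^bsub>T\<^esub> L (Y j l))"
    using assms(4,5) closed by (intro L.S.finsum_swap) auto
  also have "\<dots> = (\<Oplus>\<^bsub>T\<^esub>k\<in>{1..N}. \<Oplus>\<^bsub>T\<^esub>l\<in>{1..N}. L (X i k \<otimes>\<^bsub>A\<^esub> Y j l) \<otimes>\<^bsub>T\<^esub> R (S k l))"
    using assms(4,5) closed regroup
    by (intro L.S.finsum_cong' refl) (auto intro!: L.S.finsum_closed)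
  finally show ?thesis .
qed

end

lemma hom_twisted_matrix:
  assumes "commuting_ring_homs A A T L R" and "ring_hom_ring A T D"
    and X: "X \<in> mat_carrier A N" and G: "G \<in> mat_carrier A N" and Y: "Y \<in> mat_carrier A N"
    and DX: "mat_eq N (map_mat D X) (mat_prod T N (map_mat L X) (map_mat R X))"
    and DY: "mat_eq N (map_mat D Y) (mat_prod T N (map_mat L Y) (map_mat R Y))"
    and DG: "mat_eq N (map_mat D G) (map_mat R G)"
  defines "S \<equiv> mat_prod A N (mat_prod A N X G) (mat_transpose Y)"
  shows "mat_eq N (map_mat D S)
    (mat_prod T N (mat_prod T N (map_mat L X) (map_mat R S)) (map_mat L (mat_transpose Y)))"
proof -
  interpret commuting_ring_homs A A T L R by fact
  interpret D: ring_hom_ring A T D by fact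
  let ?Y = "mat_transpose Y" and ?mul = "mat_prod T N" and ?L = "map_mat L" and ?R = "map_mat R"
  note [intro!] = X G Y mat_transpose_closed L.map_mat_closed R.map_mat_closed
    L.R.mat_prod_closed L.S.mat_prod_closed
  note cong = L.S.mat_prod_cong and assoc = L.S.mat_prod_assoc
  have D_transpose: "mat_eq N (map_mat D ?Y) (?mul (?R ?Y) (?L ?Y))"
    using mat_eq_trans[OF mat_eq_transpose[OF DY] transpose_mat_prod[OF Y Y]]
    by (simp add: map_mat_transpose)
  have "mat_eq N (map_mat D S) (?mul (?mul (map_mat D X) (map_mat D G)) (map_mat D ?Y))"
    unfolding S_def by (intro D.hom_mat_prod3) auto
  also have "mat_eq N \<dots> (?mul (?mul (?mul (?L X) (?R X)) (?R G)) (?mul (?R ?Y) (?L ?Y)))"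
    by (intro cong DX DG D_transpose) auto
  also have "mat_eq N \<dots> (?mul (?mul (?L X) (?mul (?R X) (?R G))) (?mul (?R ?Y) (?L ?Y)))"
    by (intro cong assoc) auto
  also have "mat_eq N \<dots> (?mul (?mul (?mul (?L X) (?mul (?R X) (?R G))) (?R ?Y)) (?L ?Y))"
    by (intro mat_eq_sym[OF assoc]) auto
  also have "mat_eq N \<dots> (?mul (?mul (?L X) (?mul (?mul (?R X) (?R G)) (?R ?Y))) (?L ?Y))"
    by (intro cong assoc) auto
  also have "mat_eq N \<dots> (?mul (?mul (?L X) (?R S)) (?L ?Y))"
    unfolding S_def by (intro cong mat_eq_sym[OF R.hom_mat_prod3]) auto
  finally show ?thesis .
qed

section \<open>Tensor products of series\<close>

context complex_alg_pair
begin

abbreviation "ser_left \<equiv> \<lambda>f (r::nat). pure (f r) \<one>\<^bsub>B\<^esub>"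
abbreviation "ser_right \<equiv> \<lambda>g (r::nat). pure \<one>\<^bsub>A\<^esub> (g r)"

sublocale ser: commuting_ring_homs A.SA B.SA T.SA ser_left ser_right
proof (intro commuting_ring_homs.intro commuting_ring_homs_axioms.intro)
  show "ring_hom_ring A.SA T.SA ser_left"
    by (rule alg_hom_series[OF A.complex_alg_axioms T.complex_alg_axioms alg_hom_pure_left])
  show "ring_hom_ring B.SA T.SA ser_right"
    by (rule alg_hom_series[OF B.complex_alg_axioms T.complex_alg_axioms alg_hom_pure_right])
  show "ser_left f \<otimes>\<^bsub>T.SA\<^esub> ser_right g = ser_right g \<otimes>\<^bsub>T.SA\<^esub> ser_left f"
    if "f \<in> carrier A.SA" "g \<in> carrier B.SA" for f g
    using that by (intro T.series_mult_commute) (auto simp: series_ring_simps pure_mult)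
qed

lemma ser_right_const: "ser_right (const_series B c) = const_series T c"
  by (rule alg_hom_const_series[OF B.complex_alg_axioms T.complex_alg_axioms alg_hom_pure_right])

lemma series_tensor_eq:
  assumes "f \<in> carrier A.SA" "g \<in> carrier B.SA"
  shows "series_tensor A B f g = ser_left f \<otimes>\<^bsub>T.SA\<^esub> ser_right g"
  using assms by (simp add: series_tensor_def series_ring_simps pure_mult)

lemma series_tensor_in_sub_tensor:
  assumes "is_subalg X A" "is_subalg Z B" "\<And>r. f r \<in> X" "\<And>r. g r \<in> Z"
  shows "series_tensor A B f g r \<in> sub_tensor A B X Z"
  unfolding series_tensor_def
  using assms is_subalgE(1)[OF assms(1)] is_subalgE(1)[OF assms(2)]
  by (intro T.subalg_finsum_closed is_subalg_sub_tensor pure_in_sub_tensor)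

lemma finsum_series_tensor_nth_0:
  assumes "\<And>i. i \<in> I \<Longrightarrow> f i \<in> carrier A.SA" "\<And>i. i \<in> I \<Longrightarrow> g i \<in> carrier B.SA"
  shows "(\<Oplus>\<^bsub>T.SA\<^esub>i\<in>I. series_tensor A B (f i) (g i)) 0 = (\<Oplus>\<^bsub>T\<^esub>i\<in>I. pure (f i 0) (g i 0))"
proof -
  have "(\<Oplus>\<^bsub>T.SA\<^esub>i\<in>I. series_tensor A B (f i) (g i)) 0 = (\<Oplus>\<^bsub>T\<^esub>i\<in>I. series_tensor A B (f i) (g i) 0)"
    using assms by (intro T.finsum_series_nth) (auto simp: series_tensor_eq)
  also have "\<dots> = (\<Oplus>\<^bsub>T\<^esub>i\<in>I. pure (f i 0) (g i 0))"
    using assms by (intro T.finsum_cong') (auto simp: series_tensor_def series_ring_simps)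
  finally show ?thesis .
qed

end

section \<open>The quantum affine algebra\<close>

lemma monoid_algebra_word_monoid: "monoid_algebra (word_monoid X)"
  by (intro monoid_algebra.intro monoidI) (auto simp: word_monoid_def)

interpretation free_alg: complex_alg "free_alg X" for X
  unfolding free_alg_def
  by (rule monoid_algebra.complex_alg_monoid_alg[OF monoid_algebra_word_monoid])

lemma word_closed: "w \<in> lists X \<Longrightarrow> basis_elt w \<in> carrier (free_alg X)"
  unfolding free_alg_def
  by (rule monoid_algebra.basis_elt_closed[OF monoid_algebra_word_monoid])
     (simp add: word_monoid_def)

lemma zero_free_alg: "\<zero>\<^bsub>free_alg X\<^esub> = (\<lambda>_. 0)"
  by (simp add: free_alg_def monoid_alg_def)

lemma word_t_closed: "i \<in> {1..N} \<Longrightarrow> j \<in> {1..N} \<Longrightarrow> word_t i j r \<in> carrier (free_alg (gens N))"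
  by (rule word_closed) (auto simp: gens_def)

lemma word_tbar_closed: "i \<in> {1..N} \<Longrightarrow> j \<in> {1..N} \<Longrightarrow> word_tbar i j r \<in> carrier (free_alg (gens N))"
  by (rule word_closed) (auto simp: gens_def)

lemma Tmat_closed: "i \<in> {1..N} \<Longrightarrow> j \<in> {1..N} \<Longrightarrow> Tmat i j m \<in> carrier (free_alg (gens N))"
  using free_alg.zero_closed[of "gens N"] word_t_closed by (simp add: Tmat_def zero_free_alg)

lemma Tbarmat_closed: "i \<in> {1..N} \<Longrightarrow> j \<in> {1..N} \<Longrightarrow> Tbarmat i j m \<in> carrier (free_alg (gens N))"
  using free_alg.zero_closed[of "gens N"] word_tbar_closed by (simp add: Tbarmat_def zero_free_alg)

context complex_alg
begin

lemma poly_act_closed: "(\<And>m p. F m p \<in> carrier A) \<Longrightarrow> poly_act A P F m p \<in> carrier A"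
  unfolding poly_act_def by (intro finsum_closed Pi_I smult_closed)

lemma rtt_rels_closed:
  assumes X: "\<And>i j m. i \<in> {1..N} \<Longrightarrow> j \<in> {1..N} \<Longrightarrow> X i j m \<in> carrier A"
    and Y: "\<And>i j m. i \<in> {1..N} \<Longrightarrow> j \<in> {1..N} \<Longrightarrow> Y i j m \<in> carrier A"
  shows "rtt_rels A N q X Y \<subseteq> carrier A"
proof -
  have "rtt_left A N q X Y i j k l m p \<in> carrier A" "rtt_right A N q X Y i j k l m p \<in> carrier A"
    if "i \<in> {1..N}" "j \<in> {1..N}" "k \<in> {1..N}" "l \<in> {1..N}" for i j k l m p
    unfolding rtt_left_def rtt_right_def using that
    by (auto simp del: atLeastAtMost_iff intro!: finsum_closed poly_act_closed m_closed X Y)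
  then show ?thesis
    unfolding rtt_rels_def by (auto intro!: minus_closed)
qed

end

lemma Uq_rels_closed: "Uq_rels N q \<subseteq> carrier (free_alg (gens N))"
  unfolding Uq_rels_def Let_def
  by (intro Un_least free_alg.rtt_rels_closed Tmat_closed Tbarmat_closed)
     (auto intro!: word_t_closed word_tbar_closed free_alg.minus_closed free_alg.m_closed)

lemma ideal_Uq_ideal: "ideal (Uq_ideal N q) (free_alg (gens N))"
  unfolding Uq_ideal_def by (rule free_alg.genideal_ideal[OF Uq_rels_closed])

interpretation Uq: complex_alg "Uq N q" for N q
  unfolding Uq_def by (rule free_alg.complex_alg_alg_quot[OF ideal_Uq_ideal])

lemma t_ser_closed: "t_ser N q \<in> mat_carrier (series_ring (Uq N q)) N"
  by (auto simp: mat_carrier_def series_ring_simps Uq_def free_alg.carrier_alg_quot t_ser_def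
      word_t_closed)

lemma tbar_ser_closed: "tbar_ser N q \<in> mat_carrier (series_ring (Uq N q)) N"
  by (auto simp: mat_carrier_def series_ring_simps Uq_def free_alg.carrier_alg_quot tbar_ser_def
      word_tbar_closed)

lemma t_ser_nth_closed: "i \<in> {1..N} \<Longrightarrow> j \<in> {1..N} \<Longrightarrow> t_ser N q i j r \<in> carrier (Uq N q)"
  using mat_carrierD[OF t_ser_closed] by (simp add: series_ring_simps)

lemma tbar_ser_nth_closed: "i \<in> {1..N} \<Longrightarrow> j \<in> {1..N} \<Longrightarrow> tbar_ser N q i j r \<in> carrier (Uq N q)"
  using mat_carrierD[OF tbar_ser_closed] by (simp add: series_ring_simps)

lemma Uq_coset_eq_zero:
  assumes "x \<in> Uq_rels N q"
  shows "Uq_ideal N q +>\<^bsub>free_alg (gens N)\<^esub> x = \<zero>\<^bsub>Uq N q\<^esub>"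
proof -
  interpret I: ideal "Uq_ideal N q" "free_alg (gens N)"
    by (rule ideal_Uq_ideal)
  have "x \<in> Uq_ideal N q"
    unfolding Uq_ideal_def using assms free_alg.genideal_self[OF Uq_rels_closed] by blast
  then show ?thesis
    unfolding Uq_def free_alg.zero_alg_quot by (rule I.a_rcos_const)
qed

lemma t_ser_upper_zero:
  assumes "i \<in> {1..N}" "j \<in> {1..N}" "i < j"
  shows "t_ser N q i j 0 = \<zero>\<^bsub>Uq N q\<^esub>"
  unfolding t_ser_def
  by (rule Uq_coset_eq_zero) (use assms in \<open>unfold Uq_rels_def Let_def, blast\<close>)

lemma tbar_ser_lower_zero:
  assumes "i \<in> {1..N}" "j \<in> {1..N}" "j < i"
  shows "tbar_ser N q i j 0 = \<zero>\<^bsub>Uq N q\<^esub>"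
  unfolding tbar_ser_def
  by (rule Uq_coset_eq_zero) (use assms in \<open>unfold Uq_rels_def Let_def, blast\<close>)

lemma t_ser_tbar_ser_inverse:
  assumes "i \<in> {1..N}"
  shows "t_ser N q i i 0 \<otimes>\<^bsub>Uq N q\<^esub> tbar_ser N q i i 0 = \<one>\<^bsub>Uq N q\<^esub>"
    and "tbar_ser N q i i 0 \<otimes>\<^bsub>Uq N q\<^esub> t_ser N q i i 0 = \<one>\<^bsub>Uq N q\<^esub>"
proof -
  let ?F = "free_alg (gens N)"
  note closed = word_t_closed[OF assms assms, of 0] word_tbar_closed[OF assms assms, of 0]
  note coset_eqI = free_alg.coset_eq_if_diff_in_genideal[OF Uq_rels_closed, folded Uq_ideal_def]
  have "word_t i i 0 \<otimes>\<^bsub>?F\<^esub> word_tbar i i 0 \<ominus>\<^bsub>?F\<^esub> \<one>\<^bsub>?F\<^esub> \<in> Uq_rels N q"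
    "word_tbar i i 0 \<otimes>\<^bsub>?F\<^esub> word_t i i 0 \<ominus>\<^bsub>?F\<^esub> \<one>\<^bsub>?F\<^esub> \<in> Uq_rels N q"
    unfolding Uq_rels_def Let_def using assms by blast+
  from this[THEN coset_eqI]
  show "t_ser N q i i 0 \<otimes>\<^bsub>Uq N q\<^esub> tbar_ser N q i i 0 = \<one>\<^bsub>Uq N q\<^esub>"
    "tbar_ser N q i i 0 \<otimes>\<^bsub>Uq N q\<^esub> t_ser N q i i 0 = \<one>\<^bsub>Uq N q\<^esub>"
    using closed by (simp_all add: t_ser_def tbar_ser_def Uq_def free_alg.one_alg_quot
        free_alg.coset_mult[OF ideal_Uq_ideal])
qed

lemma t_ser_diag_Units: "i \<in> {1..N} \<Longrightarrow> t_ser N q i i 0 \<in> Units (Uq N q)"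
  unfolding Units_def using t_ser_nth_closed tbar_ser_nth_closed t_ser_tbar_ser_inverse by blast

lemma tbar_ser_diag_Units: "i \<in> {1..N} \<Longrightarrow> tbar_ser N q i i 0 \<in> Units (Uq N q)"
  unfolding Units_def using t_ser_nth_closed tbar_ser_nth_closed t_ser_tbar_ser_inverse by blast

locale Uq_coproduct =
  fixes N :: nat and q :: complex and \<Delta>
  assumes is_coproduct: "is_coproduct N q \<Delta>"
begin

abbreviation "U \<equiv> Uq N q"
abbreviation "t \<equiv> t_ser N q"
abbreviation "tbar \<equiv> tbar_ser N q"

sublocale complex_alg_pair U U ..

abbreviation "SU \<equiv> series_ring U"
abbreviation "ST \<equiv> series_ring T"

lemma coproduct_alg_hom: "\<Delta> \<in> alg_hom U T"
  using is_coproduct by (simp add: is_coproduct_def Let_def)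

sublocale \<Delta>: ring_hom_ring U T \<Delta>
  by (rule alg_homD(1)[OF Uq.complex_alg_axioms T.complex_alg_axioms coproduct_alg_hom])

sublocale \<Delta>_series: ring_hom_ring SU ST "\<lambda>f r. \<Delta> (f r)"
  by (rule alg_hom_series[OF Uq.complex_alg_axioms T.complex_alg_axioms coproduct_alg_hom])

lemma coproduct_t:
  assumes "i \<in> {1..N}" "j \<in> {1..N}"
  shows "(\<lambda>r. \<Delta> (t i j r)) = (\<Oplus>\<^bsub>ST\<^esub>k\<in>{1..N}. series_tensor U U (t i k) (t k j))"
  using is_coproduct assms unfolding is_coproduct_def Let_def by blast

lemma coproduct_tbar:
  assumes "i \<in> {1..N}" "j \<in> {1..N}"
  shows "(\<lambda>r. \<Delta> (tbar i j r)) = (\<Oplus>\<^bsub>ST\<^esub>k\<in>{1..N}. series_tensor U U (tbar i k) (tbar k j))"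
  using is_coproduct assms unfolding is_coproduct_def Let_def by blast

lemma finsum_series_tensor_eq_mat_prod:
  assumes "X \<in> mat_carrier SU N" "i \<in> {1..N}" "j \<in> {1..N}"
  shows "(\<Oplus>\<^bsub>ST\<^esub>k\<in>{1..N}. series_tensor U U (X i k) (X k j)) =
    mat_prod ST N (map_mat ser_left X) (map_mat ser_right X) i j"
  unfolding mat_prod_def map_mat_def
  using assms by (intro T.SA.finsum_cong') (auto simp: mat_carrier_def series_tensor_eq)

lemma coproduct_mat:
  shows "mat_eq N (map_mat (\<lambda>f r. \<Delta> (f r)) t)
      (mat_prod ST N (map_mat ser_left t) (map_mat ser_right t))"
    and "mat_eq N (map_mat (\<lambda>f r. \<Delta> (f r)) tbar)
      (mat_prod ST N (map_mat ser_left tbar) (map_mat ser_right tbar))"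
  by (simp_all add: mat_eq_def map_mat_def[of "\<lambda>f r. \<Delta> (f r)"] coproduct_t coproduct_tbar
      finsum_series_tensor_eq_mat_prod t_ser_closed tbar_ser_closed del: One_nat_def)

lemma coproduct_triangular_diag:
  assumes "X \<in> mat_carrier SU N" "i \<in> {1..N}"
    and "(\<lambda>r. \<Delta> (X i i r)) = (\<Oplus>\<^bsub>ST\<^esub>k\<in>{1..N}. series_tensor U U (X i k) (X k i))"
    and "\<And>k. k \<in> {1..N} \<Longrightarrow> k \<noteq> i \<Longrightarrow> X i k 0 = \<zero>\<^bsub>U\<^esub> \<or> X k i 0 = \<zero>\<^bsub>U\<^esub>"
  shows "\<Delta> (X i i 0) = pure (X i i 0) (X i i 0)"
proof -
  have closed: "X k l 0 \<in> carrier U" if "k \<in> {1..N}" "l \<in> {1..N}" for k l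
    using mat_carrierD[OF assms(1) that] by (simp add: series_ring_simps)
  have off_diagonal: "pure (X i k 0) (X k i 0) = \<zero>\<^bsub>T\<^esub>" if "k \<in> {1..N}" "k \<noteq> i" for k
    using assms(2) assms(4)[OF that] closed that by (auto simp: pure_zero_left pure_zero_right)
  have "\<Delta> (X i i 0) = (\<Oplus>\<^bsub>T\<^esub>k\<in>{1..N}. pure (X i k 0) (X k i 0))"
    using fun_cong[OF assms(3), of 0] assms(1,2)
      finsum_series_tensor_nth_0[of "{1..N}" "X i" "\<lambda>k. X k i"]
    by (simp add: mat_carrier_def)
  also have "\<dots> = pure (X i i 0) (X i i 0)"
    using assms(2) closed off_diagonal by (intro T.finsum_eq_single) auto
  finally show ?thesis .
qed

lemma coproduct_t_diag:
  assumes "i \<in> {1..N}"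
  shows "\<Delta> (t i i 0) = pure (t i i 0) (t i i 0)"
  using assms t_ser_upper_zero[of _ N _ q]
  by (intro coproduct_triangular_diag t_ser_closed coproduct_t) (auto simp: neq_iff)

lemma coproduct_tbar_diag:
  assumes "i \<in> {1..N}"
  shows "\<Delta> (tbar i i 0) = pure (tbar i i 0) (tbar i i 0)"
  using assms tbar_ser_lower_zero[of _ N _ q]
  by (intro coproduct_triangular_diag tbar_ser_closed coproduct_tbar) (auto simp: neq_iff)

end

section \<open>The symplectic twisted q-Yangian\<close>

lemma odd_index_Suc: "i \<in> {1..2 * n} \<Longrightarrow> odd i \<Longrightarrow> Suc i \<in> {1..2 * n}" for n :: nat
  by (simp, presburger)

lemma Gmat_eq_0:
  assumes "\<not> (odd i \<and> j = i + 1)" "\<not> (odd j \<and> i = j + 1)"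
  shows "Gmat n q i j = 0"
proof -
  have "mat_unit (2 * k - 1) (2 * k) i j = (0::complex)"
    "mat_unit (2 * k) (2 * k - 1) i j = (0::complex)" if "k \<in> {1..n}" for k
    using that assms by (auto simp: mat_unit_def)
  then show ?thesis
    by (simp add: Gmat_def)
qed

lemma Gmat_upper:
  assumes "i \<in> {1..2 * n}" "odd i"
  shows "Gmat n q i (Suc i) = q"
proof -
  from assms(2) obtain m where m: "i = 2 * m + 1"
    by (elim oddE)
  have "(\<Sum>k\<in>{1..n}. mat_unit (2 * k - 1) (2 * k) i (Suc i)) =
      (\<Sum>k\<in>{1..n}. if k = Suc m then 1 else (0::complex))"
    by (intro sum.cong refl) (auto simp: mat_unit_def m)
  moreover have "(\<Sum>k\<in>{1..n}. mat_unit (2 * k) (2 * k - 1) i (Suc i)) = (0::complex)"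
    by (intro sum.neutral) (auto simp: mat_unit_def m)
  ultimately show ?thesis
    using assms(1) by (simp add: Gmat_def m)
qed

definition G_ser :: "nat \<Rightarrow> complex \<Rightarrow> (nat \<Rightarrow> (gen list \<Rightarrow> complex) set) mat" where
  "G_ser n q = (\<lambda>i j. const_series (Uq (2 * n) q) (Gmat n q i j))"

lemma G_ser_closed: "G_ser n q \<in> mat_carrier (series_ring (Uq (2 * n) q)) (2 * n)"
  by (simp add: G_ser_def mat_carrier_def Uq.const_series_closed)

lemma s_ser_eq_mat_prod:
  "s_ser n q = mat_prod (series_ring (Uq (2 * n) q)) (2 * n)
    (mat_prod (series_ring (Uq (2 * n) q)) (2 * n) (t_ser (2 * n) q) (G_ser n q))
    (mat_transpose (tbar_ser (2 * n) q))"
  by (simp add: s_ser_def G_ser_def Let_def)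

lemma s_ser_closed: "s_ser n q \<in> mat_carrier (series_ring (Uq (2 * n) q)) (2 * n)"
  unfolding s_ser_eq_mat_prod
  by (intro Uq.SA.mat_prod_closed mat_transpose_closed t_ser_closed tbar_ser_closed G_ser_closed)

lemma s_ser_nth_closed:
  "i \<in> {1..2 * n} \<Longrightarrow> j \<in> {1..2 * n} \<Longrightarrow> s_ser n q i j r \<in> carrier (Uq (2 * n) q)"
  using mat_carrierD[OF s_ser_closed] by (simp add: series_ring_simps)

lemma s_ser_nth_0:
  assumes "i \<in> {1..2 * n}" "j \<in> {1..2 * n}"
  shows "s_ser n q i j 0 = (\<Oplus>\<^bsub>Uq (2 * n) q\<^esub>b\<in>{1..2 * n}.
    (\<Oplus>\<^bsub>Uq (2 * n) q\<^esub>a\<in>{1..2 * n}. t_ser (2 * n) q i a 0 \<otimes>\<^bsub>Uq (2 * n) q\<^esub> G_ser n q a b 0)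
      \<otimes>\<^bsub>Uq (2 * n) q\<^esub> tbar_ser (2 * n) q j b 0)"
  using mat_eqD[OF ring_hom_ring.hom_mat_prod3[OF Uq.coeff_0_hom t_ser_closed G_ser_closed
        mat_transpose_closed[OF tbar_ser_closed]] assms]
  by (simp add: s_ser_eq_mat_prod map_mat_def mat_prod_def mat_transpose_def)

definition s_prime_factor :: "nat \<Rightarrow> complex \<Rightarrow> nat \<Rightarrow> (gen list \<Rightarrow> complex) set" where
  "s_prime_factor n q i =
    t_ser (2 * n) q i i 0 \<otimes>\<^bsub>Uq (2 * n) q\<^esub> tbar_ser (2 * n) q (Suc i) (Suc i) 0"

lemma s_prime_factor_Units:
  "i \<in> {1..2 * n} \<Longrightarrow> odd i \<Longrightarrow> s_prime_factor n q i \<in> Units (Uq (2 * n) q)"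
  unfolding s_prime_factor_def
  by (intro Uq.Units_m_closed t_ser_diag_Units tbar_ser_diag_Units odd_index_Suc)

lemma t_G_entry_nth_0_above_diag:
  assumes i: "i \<in> {1..2 * n}" "odd i" and b: "i < b"
  shows "(\<Oplus>\<^bsub>Uq (2 * n) q\<^esub>a\<in>{1..2 * n}. t_ser (2 * n) q i a 0 \<otimes>\<^bsub>Uq (2 * n) q\<^esub> G_ser n q a b 0) =
    Gmat n q i b \<odot>\<^bsub>Uq (2 * n) q\<^esub> t_ser (2 * n) q i i 0"
proof -
  let ?U = "Uq (2 * n) q"
  note t = t_ser_nth_closed[OF i(1)]
  have summand: "t_ser (2 * n) q i a 0 \<otimes>\<^bsub>?U\<^esub> G_ser n q a b 0 = Gmat n q a b \<odot>\<^bsub>?U\<^esub> t_ser (2 * n) q i a 0"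
    if "a \<in> {1..2 * n}" for a
    using t[OF that] by (simp add: G_ser_def const_series_def Uq.smult_mult_right)
  have "t_ser (2 * n) q i a 0 \<otimes>\<^bsub>?U\<^esub> G_ser n q a b 0 = \<zero>\<^bsub>?U\<^esub>" if a: "a \<in> {1..2 * n}" "a \<noteq> i" for a
  proof (cases "a < i")
    case True
    then have "Gmat n q a b = 0"
      using i(2) b by (intro Gmat_eq_0) auto
    then show ?thesis
      using summand[OF a(1)] t[OF a(1)] by (simp add: Uq.smult_zero_left)
  next
    case False
    then show ?thesis
      using summand[OF a(1)] t_ser_upper_zero[OF i(1) a(1)] a(2) by simp
  qed
  then show ?thesis
    using i t summand[OF i(1)]
      Uq.finsum_eq_single[of "{1..2 * n}" i "\<lambda>a. t_ser (2 * n) q i a 0 \<otimes>\<^bsub>?U\<^esub> G_ser n q a b 0"]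
    by simp
qed

lemma s_ser_prime_0:
  assumes i: "i \<in> {1..2 * n}" "odd i"
  shows "s_ser n q i (idx_prime i) 0 = q \<odot>\<^bsub>Uq (2 * n) q\<^esub> s_prime_factor n q i"
proof -
  let ?U = "Uq (2 * n) q" and ?I = "{1..2 * n}"
  let ?W = "\<lambda>b. \<Oplus>\<^bsub>?U\<^esub>a\<in>?I. t_ser (2 * n) q i a 0 \<otimes>\<^bsub>?U\<^esub> G_ser n q a b 0"
  let ?tb = "\<lambda>b. tbar_ser (2 * n) q (Suc i) b 0"
  note i' = odd_index_Suc[OF i]
  have t: "t_ser (2 * n) q i i 0 \<in> carrier ?U"
    using i(1) by (intro t_ser_nth_closed)
  have tb: "?tb b \<in> carrier ?U" if "b \<in> ?I" for b
    using i' that by (intro tbar_ser_nth_closed)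
  have W: "?W b \<in> carrier ?U" if "b \<in> ?I" for b
    using i(1) that mat_carrierD[OF G_ser_closed]
    by (intro Uq.finsum_closed) (auto simp: series_ring_simps intro!: t_ser_nth_closed)
  have "s_ser n q i (idx_prime i) 0 = (\<Oplus>\<^bsub>?U\<^esub>b\<in>?I. ?W b \<otimes>\<^bsub>?U\<^esub> ?tb b)"
    using s_ser_nth_0[OF i(1) i'] i(2) by (simp add: idx_prime_def)
  also have "\<dots> = ?W (Suc i) \<otimes>\<^bsub>?U\<^esub> ?tb (Suc i)"
  proof (rule Uq.finsum_eq_single)
    fix b assume b: "b \<in> ?I" "b \<noteq> Suc i"
    show "?W b \<otimes>\<^bsub>?U\<^esub> ?tb b = \<zero>\<^bsub>?U\<^esub>"
    proof (cases "b < Suc i")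
      case True
      then show ?thesis
        using tbar_ser_lower_zero[OF i' b(1)] W[OF b(1)] by simp
    next
      case False
      then have "?W b = \<zero>\<^bsub>?U\<^esub>"
        using b(2) t t_G_entry_nth_0_above_diag[OF i, of b q] Gmat_eq_0[of i b n q]
        by (simp add: Uq.smult_zero_left)
      then show ?thesis
        using tb[OF b(1)] by simp
    qed
  qed (use i' W tb in auto)
  also have "\<dots> = q \<odot>\<^bsub>?U\<^esub> s_prime_factor n q i"
    using t tb[OF i'] t_G_entry_nth_0_above_diag[OF i, of "Suc i" q] Gmat_upper[OF i, of q]
    by (simp add: s_prime_factor_def Uq.smult_mult_left)
  finally show ?thesis .
qed

lemma s_ser_prime_0_Units:
  assumes "i \<in> {1..2 * n}" "odd i" "q \<noteq> 0"
  shows "s_ser n q i (idx_prime i) 0 \<in> Units (Uq (2 * n) q)"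
  using assms by (simp add: s_ser_prime_0 Uq.Units_smult s_prime_factor_Units)

definition Ytw_gens :: "nat \<Rightarrow> complex \<Rightarrow> (gen list \<Rightarrow> complex) set set" where
  "Ytw_gens n q = {s_ser n q i j r | i j r. i \<in> {1..2 * n} \<and> j \<in> {1..2 * n}} \<union>
    {inv\<^bsub>Uq (2 * n) q\<^esub> (s_ser n q i (idx_prime i) 0) | i. i \<in> {1..2 * n} \<and> odd i}"

lemma Ytw_sp_eq_subalg_gen: "Ytw_sp n q = subalg_gen (Uq (2 * n) q) (Ytw_gens n q)"
  unfolding Ytw_sp_def Ytw_gens_def ..

lemma Ytw_gens_subset: "q \<noteq> 0 \<Longrightarrow> Ytw_gens n q \<subseteq> carrier (Uq (2 * n) q)"
  unfolding Ytw_gens_def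
  using s_ser_nth_closed s_ser_prime_0_Units by (auto simp del: atLeastAtMost_iff)

lemma is_subalg_Ytw_sp: "q \<noteq> 0 \<Longrightarrow> is_subalg (Ytw_sp n q) (Uq (2 * n) q)"
  unfolding Ytw_sp_eq_subalg_gen by (intro Uq.is_subalg_subalg_gen Ytw_gens_subset)

lemma s_ser_in_Ytw_sp: "i \<in> {1..2 * n} \<Longrightarrow> j \<in> {1..2 * n} \<Longrightarrow> s_ser n q i j r \<in> Ytw_sp n q"
  unfolding Ytw_sp_eq_subalg_gen
  by (rule subsetD[OF subalg_gen_superset]) (unfold Ytw_gens_def, blast)

lemma inv_s_ser_in_Ytw_sp:
  "i \<in> {1..2 * n} \<Longrightarrow> odd i \<Longrightarrow> inv\<^bsub>Uq (2 * n) q\<^esub> (s_ser n q i (idx_prime i) 0) \<in> Ytw_sp n q"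
  unfolding Ytw_sp_eq_subalg_gen
  by (rule subsetD[OF subalg_gen_superset]) (unfold Ytw_gens_def, blast)

locale twisted_coproduct = Uq_coproduct "2 * n" q \<Delta> for n q \<Delta> +
  assumes q_nonzero: "q \<noteq> 0"
begin

abbreviation "I \<equiv> {1..2 * n}"
abbreviation "s \<equiv> s_ser n q"
abbreviation "Y \<equiv> Ytw_sp n q"
abbreviation "U_tensor_Y \<equiv> sub_tensor U U (carrier U) Y"

lemma coproduct_s:
  assumes "i \<in> I" "j \<in> I"
  shows "(\<lambda>r. \<Delta> (s i j r)) =
    (\<Oplus>\<^bsub>ST\<^esub>k\<in>I. \<Oplus>\<^bsub>ST\<^esub>l\<in>I. series_tensor U U (t i k \<otimes>\<^bsub>SU\<^esub> tbar j l) (s k l))"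
proof -
  have "mat_eq (2 * n) (map_mat (\<lambda>f r. \<Delta> (f r)) (G_ser n q)) (map_mat ser_right (G_ser n q))"
    using alg_hom_const_series[OF Uq.complex_alg_axioms T.complex_alg_axioms coproduct_alg_hom]
    by (simp add: mat_eq_def map_mat_def G_ser_def ser_right_const)
  note \<Delta>_s = hom_twisted_matrix[OF ser.commuting_ring_homs_axioms \<Delta>_series.ring_hom_ring_axioms
      t_ser_closed G_ser_closed tbar_ser_closed coproduct_mat this, folded s_ser_eq_mat_prod]
  have "(\<lambda>r. \<Delta> (s i j r)) = map_mat (\<lambda>f r. \<Delta> (f r)) s i j"
    by (simp add: map_mat_def)
  also have "\<dots> = (\<Oplus>\<^bsub>ST\<^esub>k\<in>I. \<Oplus>\<^bsub>ST\<^esub>l\<in>I. ser_left (t i k \<otimes>\<^bsub>SU\<^esub> tbar j l) \<otimes>\<^bsub>ST\<^esub> ser_right (s k l))"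
    using mat_eqD[OF \<Delta>_s assms]
      ser.mat_prod_left_right_left[OF t_ser_closed s_ser_closed tbar_ser_closed assms]
    by simp
  also have "\<dots> = (\<Oplus>\<^bsub>ST\<^esub>k\<in>I. \<Oplus>\<^bsub>ST\<^esub>l\<in>I. series_tensor U U (t i k \<otimes>\<^bsub>SU\<^esub> tbar j l) (s k l))"
    using assms mat_carrierD[OF t_ser_closed] mat_carrierD[OF tbar_ser_closed]
      mat_carrierD[OF s_ser_closed]
    by (intro T.SA.finsum_cong' refl) (auto simp: series_tensor_eq intro!: T.SA.finsum_closed)
  finally show ?thesis .
qed

lemma is_subalg_U_tensor_Y: "is_subalg U_tensor_Y T"
  by (intro is_subalg_sub_tensor Uq.is_subalg_carrier is_subalg_Ytw_sp q_nonzero)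

lemma coproduct_s_in_U_tensor_Y:
  assumes "i \<in> I" "j \<in> I"
  shows "\<Delta> (s i j r) \<in> U_tensor_Y"
proof -
  have "series_tensor U U (t i k \<otimes>\<^bsub>SU\<^esub> tbar j l) (s k l) r' \<in> U_tensor_Y"
    if "k \<in> I" "l \<in> I" for k l r'
  proof (rule series_tensor_in_sub_tensor[OF Uq.is_subalg_carrier is_subalg_Ytw_sp[OF q_nonzero]])
    have "t i k \<otimes>\<^bsub>SU\<^esub> tbar j l \<in> carrier SU"
      using assms that
      by (intro Uq.SA.m_closed mat_carrierD[OF t_ser_closed] mat_carrierD[OF tbar_ser_closed])
    then show "(t i k \<otimes>\<^bsub>SU\<^esub> tbar j l) r'' \<in> carrier U" for r''
      unfolding series_ring_simps(1) ..
    show "s k l r'' \<in> Y" for r''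
      using that by (rule s_ser_in_Ytw_sp)
  qed
  then show ?thesis
    unfolding fun_cong[OF coproduct_s[OF assms]]
    by (intro T.subalg_finsum_series_closed is_subalg_U_tensor_Y)
qed

lemma coproduct_s_prime:
  assumes "i \<in> I" "odd i"
  shows "\<Delta> (s i (idx_prime i) 0) = pure (s_prime_factor n q i) (s i (idx_prime i) 0)"
proof -
  let ?x = "s_prime_factor n q i"
  note i' = odd_index_Suc[OF assms]
  have x: "?x \<in> carrier U"
    using s_prime_factor_Units[OF assms] by (rule Uq.Units_closed)
  have "\<Delta> ?x = pure ?x ?x"
    using assms(1) i' unfolding s_prime_factor_def
    by (simp add: coproduct_t_diag coproduct_tbar_diag pure_mult t_ser_nth_closed
        tbar_ser_nth_closed)
  then show ?thesis
    using x alg_homD(2)[OF Uq.complex_alg_axioms T.complex_alg_axioms coproduct_alg_hom x]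
    by (simp add: s_ser_prime_0[OF assms] pure_smult_right)
qed

lemma coproduct_inv_s_prime:
  assumes "i \<in> I" "odd i"
  shows "\<Delta> (inv\<^bsub>U\<^esub> (s i (idx_prime i) 0)) =
    pure (inv\<^bsub>U\<^esub> (s_prime_factor n q i)) (inv\<^bsub>U\<^esub> (s i (idx_prime i) 0))"
  using s_ser_prime_0_Units[OF assms q_nonzero] s_prime_factor_Units[OF assms]
  by (simp add: \<Delta>.hom_inv coproduct_s_prime[OF assms] inv_pure)

lemma coproduct_inv_s_prime_in_U_tensor_Y:
  assumes "i \<in> I" "odd i"
  shows "\<Delta> (inv\<^bsub>U\<^esub> (s i (idx_prime i) 0)) \<in> U_tensor_Y"
  unfolding coproduct_inv_s_prime[OF assms]
  by (intro pure_in_sub_tensor inv_s_ser_in_Ytw_sp assms Uq.Units_inv_closed s_prime_factor_Units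
      is_subalgE(1) is_subalg_Ytw_sp q_nonzero subset_refl)

lemma coideal: "\<Delta> ` Y \<subseteq> U_tensor_Y"
proof -
  have "Ytw_gens n q \<subseteq> {y \<in> carrier U. \<Delta> y \<in> U_tensor_Y}"
    using Ytw_gens_subset[OF q_nonzero] coproduct_s_in_U_tensor_Y
      coproduct_inv_s_prime_in_U_tensor_Y
    unfolding Ytw_gens_def by blast
  moreover have "is_subalg {y \<in> carrier U. \<Delta> y \<in> U_tensor_Y} U"
    by (rule is_subalg_vimage[OF Uq.complex_alg_axioms T.complex_alg_axioms coproduct_alg_hom
        is_subalg_U_tensor_Y])
  ultimately have "Y \<subseteq> {y \<in> carrier U. \<Delta> y \<in> U_tensor_Y}"
    unfolding Ytw_sp_eq_subalg_gen by (intro subalg_gen_minimal)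
  then show ?thesis
    by blast
qed

end

theorem proposition3p13:
  fixes q :: complex and n :: nat
    and \<Delta> :: "(gen list \<Rightarrow> complex) set \<Rightarrow>
               ((gen list \<Rightarrow> complex) set \<times> (gen list \<Rightarrow> complex) set \<Rightarrow> complex) set"
  assumes "q \<noteq> 0"
    and "\<And>m::nat. m > 0 \<Longrightarrow> q ^ m \<noteq> 1"
    and "is_coproduct (2 * n) q \<Delta>"
  shows "\<Delta> ` Ytw_sp n q
           \<subseteq> sub_tensor (Uq (2 * n) q) (Uq (2 * n) q) (carrier (Uq (2 * n) q)) (Ytw_sp n q)
       \<and> (\<forall>i\<in>{1..2 * n}. \<forall>j\<in>{1..2 * n}.
            (\<lambda>r. \<Delta> (s_ser n q i j r)) =
              (\<Oplus>\<^bsub>series_ring (alg_tensor (Uq (2 * n) q) (Uq (2 * n) q))\<^esub>k\<in>{1..2 * n}.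
               \<Oplus>\<^bsub>series_ring (alg_tensor (Uq (2 * n) q) (Uq (2 * n) q))\<^esub>l\<in>{1..2 * n}.
                 series_tensor (Uq (2 * n) q) (Uq (2 * n) q)
                   (t_ser (2 * n) q i k
                      \<otimes>\<^bsub>series_ring (Uq (2 * n) q)\<^esub> tbar_ser (2 * n) q j l)
                   (s_ser n q k l)))"
proof -
  interpret twisted_coproduct n q \<Delta>
    by unfold_locales (fact assms)+
  show ?thesis
    using coideal coproduct_s by blast
qed

end
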